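(* Let $\varphi$ be a nontrivial endomorphism of a finitely generated virtually free group $G$ (nontrivial meaning $G\varphi\neq 1$) and let $d \in V^A(p,\gamma,T)$ be a visual metric on $G$, where $A$ is a finite generating set of $G$, $p\in G$, $\gamma>0$ and $T\geq 1$. Then the following conditions are equivalent: (i) $\varphi$ is uniformly continuous with respect to $d$; (ii) $\varphi$ satisfies a Hölder condition with respect to $d$; (iii) $\varphi$ admits a continuous extension to the completion $(\widehat{G},\widehat{d})$; (iv) $\varphi$ admits an extension to $\widehat{G}$ satisfying a Hölder condition with respect to $\widehat{d}$; (v) there exist constants $P > 0$ and $Q \in \mathbb{R}$ such that $P(g\varphi|h\varphi)_p^A + Q \geq (g|h)_p^A$ for all $g,h \in G$; (vi) $\varphi$ is a quasi-isometric embedding of $(G,d_A)$ into itself; (vii) $\varphi$ is virtually injective.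
   Context: Maps are written on the right. All generating sets are finite. A group is virtually free if it has a free subgroup of finite index; finitely generated virtually free groups are hyperbolic. For $G = \langle A\rangle$, $\widetilde{A} = A \cup A^{-1}$, and $d_A(g,h)$ is the length of a shortest path from $g$ to $h$ in the Cayley graph $\Gamma_A(G)$ (vertex set $G$, edges $g \to ga$ for $a \in \widetilde{A}$). Gromov product: $(g|h)_p^A = \frac12(d_A(p,g)+d_A(p,h)-d_A(g,h))$ for $g,h,p\in G$. Let $\rho^A_{p,\gamma}(g,h) = e^{-\gamma (g|h)_p^A}$ if $g \ne h$ and $0$ otherwise. For $p \in G$, $\gamma>0$, $T\ge 1$, $V^A(p,\gamma,T)$ is the set of all metrics $d$ on $G$ with $\frac1T\rho^A_{p,\gamma}(g,h) \le d(g,h) \le T\rho^A_{p,\gamma}(g,h)$ for all distinct $g,h\in G$; the metrics in such sets are called visual metrics. $(\widehat{G},\widehat{d})$ denotes the metric completion of $(G,d)$ (so $\widehat{G} = G \cup \partial G$, where $\partial G$ is the Gromov boundary). A map $\varphi:(X,d)\to(X',d')$ satisfies a Hölder condition of exponent $r>0$ if there is $K>0$ with $d'(x\varphi,y\varphi)\le K\,d(x,y)^r$ for all $x,y\in X$; it satisfies a Hölder condition if this holds for some $r>0$. It is a quasi-isometric embedding if there are $\lambda\ge1$, $K\ge0$ with $\frac1\lambda d(x,y)-K\le d'(x\varphi,y\varphi)\le\lambda d(x,y)+K$ for all $x,y\in X$. An endomorphism is virtually injective if its kernel is finite. *)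

theory Defs
  imports "HOL-Analysis.Analysis" "HOL-Algebra.Generated_Groups"
begin

section \<open>Virtually free groups\<close>

text \<open>Words in the letters \<open>x\<close> and \<open>x\<inverse>\<close>, for \<open>x\<close> in a set \<open>X\<close>, are lists of pairs: \<open>(True, x)\<close> stands
  for \<open>x\<close> and \<open>(False, x)\<close> for \<open>x\<inverse>\<close>.\<close>

definition words_over :: "'a set \<Rightarrow> (bool \<times> 'a) list set"
  where "words_over X = lists (UNIV \<times> X)"

definition reduced_word :: "(bool \<times> 'a) list \<Rightarrow> bool"
  where "reduced_word w \<longleftrightarrow> successively (\<lambda>u v. \<not> (snd u = snd v \<and> fst u \<noteq> fst v)) w"

fun word_value :: "('a, 'm) monoid_scheme \<Rightarrow> (bool \<times> 'a) list \<Rightarrow> 'a"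
  where
    "word_value G [] = \<one>\<^bsub>G\<^esub>"
  | "word_value G ((e, x) # w) = (if e then x else inv\<^bsub>G\<^esub> x) \<otimes>\<^bsub>G\<^esub> word_value G w"

text \<open>\<open>G\<close> is free on \<open>X\<close> if the canonical map from the free group on \<open>X\<close>, realized on the
  reduced words over \<open>X\<close>, to \<open>G\<close> is bijective.\<close>

definition free_basis :: "('a, 'm) monoid_scheme \<Rightarrow> 'a set \<Rightarrow> bool"
  where "free_basis G X \<longleftrightarrow>
    X \<subseteq> carrier G \<and> bij_betw (word_value G) {w \<in> words_over X. reduced_word w} (carrier G)"

definition free_group :: "('a, 'm) monoid_scheme \<Rightarrow> bool"
  where "free_group G \<longleftrightarrow> group G \<and> (\<exists>X. free_basis G X)"

definition virtually_free :: "('a, 'm) monoid_scheme \<Rightarrow> bool"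
  where "virtually_free G \<longleftrightarrow>
    (\<exists>H. subgroup H G \<and> finite (rcosets\<^bsub>G\<^esub> H) \<and> free_group (G\<lparr>carrier := H\<rparr>))"

definition virtually_injective :: "('a, 'm) monoid_scheme \<Rightarrow> ('a \<Rightarrow> 'a) \<Rightarrow> bool"
  where "virtually_injective G \<phi> \<longleftrightarrow> finite (kernel G G \<phi>)"


section \<open>Word metric, Gromov product and visual metrics\<close>

definition cayley_edges :: "('a, 'm) monoid_scheme \<Rightarrow> 'a set \<Rightarrow> ('a \<times> 'a) set"
  where "cayley_edges G A =
    {(g, g \<otimes>\<^bsub>G\<^esub> a) |g a. g \<in> carrier G \<and> a \<in> A \<union> (\<lambda>x. inv\<^bsub>G\<^esub> x) ` A}"

text \<open>The minimum below is over the lengths of the paths from \<open>g\<close> to \<open>h\<close>; it is attained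
  whenever \<open>A\<close> generates \<open>G\<close>.\<close>

definition word_dist :: "('a, 'm) monoid_scheme \<Rightarrow> 'a set \<Rightarrow> 'a \<Rightarrow> 'a \<Rightarrow> real"
  where "word_dist G A g h = real (LEAST n. (g, h) \<in> cayley_edges G A ^^ n)"

definition gromov_product ::
    "('a, 'm) monoid_scheme \<Rightarrow> 'a set \<Rightarrow> 'a \<Rightarrow> 'a \<Rightarrow> 'a \<Rightarrow> real"
  where "gromov_product G A p g h =
    (word_dist G A p g + word_dist G A p h - word_dist G A g h) / 2"

definition visual_rho ::
    "('a, 'm) monoid_scheme \<Rightarrow> 'a set \<Rightarrow> 'a \<Rightarrow> real \<Rightarrow> 'a \<Rightarrow> 'a \<Rightarrow> real"
  where "visual_rho G A p \<gamma> g h =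
    (if g \<noteq> h then exp (- \<gamma> * gromov_product G A p g h) else 0)"

definition visual_metrics ::
    "('a, 'm) monoid_scheme \<Rightarrow> 'a set \<Rightarrow> 'a \<Rightarrow> real \<Rightarrow> real \<Rightarrow> ('a \<Rightarrow> 'a \<Rightarrow> real) set"
  where "visual_metrics G A p \<gamma> T = {d. Metric_space (carrier G) d \<and>
    (\<forall>g\<in>carrier G. \<forall>h\<in>carrier G. g \<noteq> h \<longrightarrow>
      1 / T * visual_rho G A p \<gamma> g h \<le> d g h \<and> d g h \<le> T * visual_rho G A p \<gamma> g h)}"


section \<open>Maps between metric spaces\<close>

definition Holder_condition ::
    "'a set \<Rightarrow> ('a \<Rightarrow> 'a \<Rightarrow> real) \<Rightarrow> 'b set \<Rightarrow> ('b \<Rightarrow> 'b \<Rightarrow> real) \<Rightarrow> ('a \<Rightarrow> 'b) \<Rightarrow> bool"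
  where "Holder_condition X d X' d' f \<longleftrightarrow> f \<in> X \<rightarrow> X' \<and>
    (\<exists>r>0. \<exists>K>0. \<forall>x\<in>X. \<forall>y\<in>X. d' (f x) (f y) \<le> K * d x y powr r)"

definition quasi_isometric_embedding ::
    "'a set \<Rightarrow> ('a \<Rightarrow> 'a \<Rightarrow> real) \<Rightarrow> 'b set \<Rightarrow> ('b \<Rightarrow> 'b \<Rightarrow> real) \<Rightarrow> ('a \<Rightarrow> 'b) \<Rightarrow> bool"
  where "quasi_isometric_embedding X d X' d' f \<longleftrightarrow> f \<in> X \<rightarrow> X' \<and>
    (\<exists>L\<ge>1. \<exists>K\<ge>0. \<forall>x\<in>X. \<forall>y\<in>X.
      1 / L * d x y - K \<le> d' (f x) (f y) \<and> d' (f x) (f y) \<le> L * d x y + K)"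

text \<open>The completion is determined only up to isometry, so \<open>(N, e)\<close> may be any complete metric
  space containing \<open>(M, d)\<close> densely via the isometric embedding \<open>\<iota>\<close>. Lemma \<open>metric_completion_exists\<close>
  provides one.\<close>

definition metric_completion_of ::
    "'a set \<Rightarrow> ('a \<Rightarrow> 'a \<Rightarrow> real) \<Rightarrow> ('a \<Rightarrow> 'b) \<Rightarrow> 'b set \<Rightarrow> ('b \<Rightarrow> 'b \<Rightarrow> real) \<Rightarrow> bool"
  where "metric_completion_of M d \<iota> N e \<longleftrightarrow>
    Metric_space N e \<and> Metric_space.mcomplete N e \<and>
    \<iota> \<in> M \<rightarrow> N \<and> (\<forall>x\<in>M. \<forall>y\<in>M. e (\<iota> x) (\<iota> y) = d x y) \<and>
    Metric_space.mtopology N e closure_of (\<iota> ` M) = N"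

lemma metric_completion_exists:
  fixes M :: "'a set"
  assumes "Metric_space M d"
  shows "\<exists>(\<iota> :: 'a \<Rightarrow> 'a \<Rightarrow> real) N e. metric_completion_of M d \<iota> N e"
proof -
  obtain f :: "'a \<Rightarrow> 'a \<Rightarrow> real" and m where
    "mcomplete_of m" "f \<in> M \<rightarrow> mspace m" "mtopology_of m closure_of f ` M = mspace m"
    "\<And>x y. \<lbrakk>x \<in> M; y \<in> M\<rbrakk> \<Longrightarrow> mdist m (f x) (f y) = d x y"
    using Metric_space.metric_completion[OF assms] by metis
  then have "metric_completion_of M d f (mspace m) (mdist m)"
    unfolding metric_completion_of_def mcomplete_of_def mtopology_of_def by simp
  then show ?thesis by blast
qed

definition extends_along :: "'a set \<Rightarrow> ('a \<Rightarrow> 'b) \<Rightarrow> ('a \<Rightarrow> 'a) \<Rightarrow> ('b \<Rightarrow> 'b) \<Rightarrow> bool"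
  where "extends_along M \<iota> f F \<longleftrightarrow> (\<forall>x\<in>M. F (\<iota> x) = \<iota> (f x))"

definition all_equivalent :: "bool list \<Rightarrow> bool"
  where "all_equivalent Ps \<longleftrightarrow> (\<forall>P\<in>set Ps. \<forall>Q\<in>set Ps. P \<longleftrightarrow> Q)"

end

theory Submission
  imports Defs "HOL-Library.Sublist"
begin

text \<open>The one deep implication is that a finite kernel gives the Gromov product inequality (v).
  Splitting off coset representatives of a free subgroup of finite index and taking normal forms
  gives a map \<open>f\<close> from \<open>G\<close> to the tree of words which is coarsely Lipschitz and proper; if
  \<open>ker \<phi>\<close> is finite, then \<open>f \<circ> \<phi>\<close> has the same two properties. For any such map \<open>\<psi>\<close>, the image of a
  geodesic of \<open>G\<close> passes near every vertex of the tree geodesic between its ends. This makes \<open>\<psi>\<close> a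
  quasi-isometric embedding, and bounds \<open>(g|h)\<close> above and below, up to affine distortion, by
  the length of the common prefix of \<open>\<psi> g\<close> and \<open>\<psi> h\<close>; apply the upper bound to \<open>f \<circ> \<phi>\<close> at \<open>g, h\<close> and
  the lower bound to \<open>f\<close> at \<open>\<phi> g, \<phi> h\<close>. Conversely, an infinite kernel gives points \<open>s n\<close> and \<open>s n k\<close>
  that merge at infinity while their images stay at a fixed positive distance.\<close>

section \<open>Words as vertices of a tree\<close>

text \<open>In the tree whose edges append one letter, \<open>u\<close> and \<open>v\<close> are at distance at most \<open>n\<close>.\<close>

definition close :: "nat \<Rightarrow> 'l list \<Rightarrow> 'l list \<Rightarrow> bool"
  where "close n u v \<longleftrightarrow> (\<exists>c u' v'. u = c @ u' \<and> v = c @ v' \<and> length u' + length v' \<le> n)"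

lemma closeI: "u = c @ u' \<Longrightarrow> v = c @ v' \<Longrightarrow> length u' + length v' \<le> n \<Longrightarrow> close n u v"
  unfolding close_def by blast

lemma close_mono: "close m u v \<Longrightarrow> m \<le> n \<Longrightarrow> close n u v"
  unfolding close_def using order_trans by blast

lemma close_refl: "close 0 u u"
  unfolding close_def by auto

lemma close_length: "close n u v \<Longrightarrow> length v \<le> length u + n"
  unfolding close_def by auto

lemma close_append:
  assumes "close n u v"
  shows "close (Suc n) u (v @ [l])"
proof -
  obtain c u' v' where "u = c @ u'" "v = c @ v'" "length u' + length v' \<le> n"
    using assms unfolding close_def by blast
  then show ?thesis
    by (intro closeI[of _ c u' _ "v' @ [l]"]) auto
qed

lemma close_butlast:
  assumes "close n u (v @ [l])"
  shows "close (Suc n) u v"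
proof -
  obtain c u' v' where c: "u = c @ u'" "v @ [l] = c @ v'" "length u' + length v' \<le> n"
    using assms unfolding close_def by blast
  show ?thesis
  proof (cases v' rule: rev_cases)
    \<comment> \<open>Here the common prefix is all of \<open>v @ [l]\<close>; cutting it back to
      \<open>v\<close> hands the letter \<open>l\<close> over to the remainder of
      \<open>u\<close>.\<close>
    case Nil
    then show ?thesis
      using c by (intro closeI[of _ v "l # u'" _ "[]"]) auto
  next
    case (snoc w z)
    then show ?thesis
      using c by (intro closeI[of _ c u' _ w]) auto
  qed
qed

text \<open>The first word of the chain with prefix \<open>c\<close> is near \<open>c\<close>, as the tree edge leading to \<open>c\<close> has
  to be crossed.\<close>

lemma chain_crosses_prefix:
  assumes "\<And>i. i < n \<Longrightarrow> close D (x i) (x (Suc i))" "prefix c (x n)"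
  shows "prefix c (x 0) \<or> (\<exists>i\<le>n. prefix c (x i) \<and> length (x i) < length c + D)"
  using assms
proof (induction n)
  case (Suc n)
  show ?case
  proof (cases "prefix c (x n)")
    case True
    then show ?thesis
      using Suc by (metis le_SucI less_SucI)
  next
    case False
    obtain e u v where e: "x n = e @ u" "x (Suc n) = e @ v" "length u + length v \<le> D"
      using Suc.prems(1)[of n] unfolding close_def by auto
    \<comment> \<open>Only the later word extends \<open>c\<close>, so the common part
      \<open>e\<close> is a proper prefix of \<open>c\<close>. The later word exceeds
      \<open>e\<close> by at most \<open>D\<close> letters, hence \<open>c\<close> by fewer than
      \<open>D\<close>.\<close>
    have "\<not> prefix c e"
      using False e(1) by auto
    then have "prefix e c" "e \<noteq> c"
      using Suc.prems(2) e(2) by (auto simp: prefix_append)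
    then have "length e < length c"
      using prefix_length_less strict_prefix_def by blast
    then show ?thesis
      using e(2,3) Suc.prems(2) by (intro disjI2 exI[of _ "Suc n"]) auto
  qed
qed simp

text \<open>If \<open>c\<close> is a prefix of \<open>x 0\<close> already, the bound on
  \<open>length (x 0)\<close> makes \<open>x 0\<close> itself a word near \<open>c\<close>;
  otherwise the crossing of the edge into \<open>c\<close> supplies one.\<close>

lemma chain_near_prefix:
  assumes "\<And>i. i < n \<Longrightarrow> close D (x i) (x (Suc i))" "prefix c (x n)" "length (x 0) \<le> D"
  obtains i u where "i \<le> n" "x i = c @ u" "length u \<le> D"
proof -
  consider "prefix c (x 0)" | i where "i \<le> n" "prefix c (x i)" "length (x i) < length c + D"
    using chain_crosses_prefix[OF assms(1,2)] by blast
  then show ?thesis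
  proof cases
    case 1
    then show ?thesis
      using that[of 0] assms(3) by (auto simp: prefix_def)
  next
    case 2
    then show ?thesis
      using that[of i] by (auto simp: prefix_def)
  qed
qed

text \<open>The branch point of the two ends is their longest common prefix \<open>c\<close>. Unless
  \<open>c\<close> is the last word, the chain crosses the tree edge that leaves \<open>c\<close>
  towards \<open>x n\<close>, and the word reached there is near \<open>c\<close>.\<close>

lemma chain_near_branch_point:
  assumes "\<And>i. i < n \<Longrightarrow> close D (x i) (x (Suc i))"
  obtains c i u where "prefix c (x 0)" "prefix c (x n)" "i \<le> n" "x i = c @ u" "length u \<le> D"
proof -
  let ?c = "longest_common_prefix (x 0) (x n)"
  show ?thesis
  proof (cases "?c = x n")
    case True
    then show ?thesis
      using that[of ?c n "[]"] longest_common_prefix_prefix1[of "x 0" "x n"] by simp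
  next
    case False
    then obtain b v where b: "x n = ?c @ b # v"
      by (metis longest_common_prefix_prefix2 prefix_def append_Nil2 list.exhaust)
    then have pre: "prefix (?c @ [b]) (x n)"
      by (metis Cons_prefix_Cons Nil_prefix same_prefix_prefix)
    then have "\<not> prefix (?c @ [b]) (x 0)"
      using longest_common_prefix_max_prefix[of "?c @ [b]" "x 0" "x n"] prefix_length_le by fastforce
    \<comment> \<open>The strict bound, for a prefix one letter longer than the branch point, leaves
      a remainder of at most \<open>D\<close> letters after the branch point itself.\<close>
    then obtain i where i: "i \<le> n" "prefix (?c @ [b]) (x i)" "length (x i) < length (?c @ [b]) + D"
      using chain_crosses_prefix[OF assms pre] by blast
    from i(2) obtain w where "x i = ?c @ b # w"
      by (auto simp: prefix_def)
    then show ?thesis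
      using that[of ?c i "b # w"] i(1,3)
      by (auto simp: longest_common_prefix_prefix1 longest_common_prefix_prefix2)
  qed
qed

section \<open>Word metrics\<close>

locale marked_group = group G for G (structure) +
  fixes A :: "'a set"
  assumes finite_A: "finite A" and A_subset: "A \<subseteq> carrier G" and gen_A: "generate G A = carrier G"
begin

abbreviation wd :: "'a \<Rightarrow> 'a \<Rightarrow> real" where "wd \<equiv> word_dist G A"

abbreviation edges :: "('a \<times> 'a) set" where "edges \<equiv> cayley_edges G A"

abbreviation letters :: "'a set" where "letters \<equiv> A \<union> (\<lambda>x. inv x) ` A"

lemma finite_letters: "finite letters"
  using finite_A by simp

lemma letters_closed: "a \<in> letters \<Longrightarrow> a \<in> carrier G"
  using A_subset by auto

lemma letters_inv: "a \<in> letters \<Longrightarrow> inv a \<in> letters"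
  using A_subset by auto

lemma edges_iff: "(x, y) \<in> edges \<longleftrightarrow> x \<in> carrier G \<and> (\<exists>a\<in>letters. y = x \<otimes> a)"
  unfolding cayley_edges_def by blast

lemma letter_edge: "a \<in> letters \<Longrightarrow> (\<one>, a) \<in> edges"
  unfolding edges_iff using letters_closed[of a] by (auto intro!: bexI[of _ a] simp del: Un_iff)

lemma edges_sym:
  assumes "(x, y) \<in> edges"
  shows "(y, x) \<in> edges"
proof -
  obtain a where a: "x \<in> carrier G" "a \<in> letters" "y = x \<otimes> a"
    using assms edges_iff by blast
  then have "x = y \<otimes> inv a"
    using letters_closed by (simp add: m_assoc)
  then show ?thesis
    using a letters_closed letters_inv edges_iff by (metis m_closed)
qed

lemma relpow_edges_closed:
  assumes "(x, y) \<in> edges ^^ n" "x \<in> carrier G"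
  shows "y \<in> carrier G"
  using assms
proof (induction n arbitrary: y)
  case (Suc n)
  then show ?case
    using letters_closed by (metis edges_iff m_closed relpow_Suc_E)
qed simp

lemma relpow_edges_sym: "(x, y) \<in> edges ^^ n \<Longrightarrow> (y, x) \<in> edges ^^ n"
proof (induction n arbitrary: y)
  case (Suc n)
  then show ?case
    by (meson edges_sym relpow_Suc_E relpow_Suc_I2)
qed simp

lemma relpow_edges_translate:
  assumes "(x, y) \<in> edges ^^ n" "x \<in> carrier G" "g \<in> carrier G"
  shows "(g \<otimes> x, g \<otimes> y) \<in> edges ^^ n"
  using assms
proof (induction n arbitrary: y)
  case (Suc n)
  then obtain z where z: "(x, z) \<in> edges ^^ n" "(z, y) \<in> edges"
    by auto
  then obtain a where "z \<in> carrier G" "a \<in> letters" "y = z \<otimes> a"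
    using edges_iff by blast
  then have "(g \<otimes> z, g \<otimes> y) \<in> edges"
    using edges_iff letters_closed m_assoc m_closed Suc.prems(3) by metis
  then show ?case
    using Suc z by (meson relpow_Suc_I)
qed simp

lemma generate_reachable: "g \<in> generate G A \<Longrightarrow> \<exists>n. (\<one>, g) \<in> edges ^^ n"
proof (induction rule: generate.induct)
  case one
  show ?case
    by (rule exI[of _ 0]) simp
next
  case (incl h)
  then show ?case
    using letter_edge by (intro exI[of _ 1]) simp
next
  case (inv h)
  then show ?case
    using letter_edge by (intro exI[of _ 1]) simp
next
  case (eng g h)
  then obtain m n where "(\<one>, g) \<in> edges ^^ m" "(\<one>, h) \<in> edges ^^ n"
    by blast
  moreover have "g \<in> carrier G"
    using eng gen_A by simp
  ultimately have "(\<one>, g \<otimes> h) \<in> edges ^^ (m + n)"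
    using relpow_edges_translate[of \<one> h n g] relpow_trans by fastforce
  then show ?case
    by blast
qed

lemma reachable:
  assumes "x \<in> carrier G" "y \<in> carrier G"
  shows "\<exists>n. (x, y) \<in> edges ^^ n"
proof -
  obtain n where "(\<one>, inv x \<otimes> y) \<in> edges ^^ n"
    using generate_reachable gen_A assms by (metis inv_closed m_closed)
  then have "(x \<otimes> \<one>, x \<otimes> (inv x \<otimes> y)) \<in> edges ^^ n"
    using relpow_edges_translate assms(1) one_closed by blast
  then show ?thesis
    using assms by (metis inv_solve_left inv_closed m_closed r_one)
qed

lemma generators_induct [consumes 1, case_names one step]:
  assumes "x \<in> carrier G" "P \<one>" "\<And>x a. x \<in> carrier G \<Longrightarrow> a \<in> letters \<Longrightarrow> P x \<Longrightarrow> P (x \<otimes> a)"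
  shows "P x"
proof -
  obtain n where "(\<one>, x) \<in> edges ^^ n"
    using reachable assms(1) by blast
  then show ?thesis
  proof (induction n arbitrary: x)
    case (Suc n)
    then show ?case
      using assms(3) by (metis edges_iff relpow_Suc_E)
  qed (use assms(2) in simp)
qed

lemma wd_attained:
  assumes "x \<in> carrier G" "y \<in> carrier G"
  obtains n where "(x, y) \<in> edges ^^ n" "wd x y = real n"
  using LeastI_ex[OF reachable[OF assms]] unfolding word_dist_def by blast

lemma wd_le: "(x, y) \<in> edges ^^ n \<Longrightarrow> wd x y \<le> real n"
  unfolding word_dist_def by (simp add: Least_le)

lemma wd_nonneg: "0 \<le> wd x y"
  unfolding word_dist_def by simp

lemma wd_self [simp]: "wd x x = 0"
  using wd_le[of x x 0] wd_nonneg[of x x] by simp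

lemma wd_triangle:
  assumes "x \<in> carrier G" "y \<in> carrier G" "z \<in> carrier G"
  shows "wd x z \<le> wd x y + wd y z"
proof -
  obtain m n where "(x, y) \<in> edges ^^ m" "wd x y = real m" "(y, z) \<in> edges ^^ n" "wd y z = real n"
    using wd_attained assms by metis
  then show ?thesis
    using wd_le[OF relpow_trans] by fastforce
qed

lemma wd_sym: "x \<in> carrier G \<Longrightarrow> y \<in> carrier G \<Longrightarrow> wd x y = wd y x"
  by (metis order_antisym relpow_edges_sym wd_attained wd_le)

lemma wd_translate_le:
  assumes "x \<in> carrier G" "y \<in> carrier G" "g \<in> carrier G"
  shows "wd (g \<otimes> x) (g \<otimes> y) \<le> wd x y"
  using assms by (metis relpow_edges_translate wd_attained wd_le)

lemma wd_translate:
  assumes "x \<in> carrier G" "y \<in> carrier G" "g \<in> carrier G"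
  shows "wd (g \<otimes> x) (g \<otimes> y) = wd x y"
proof -
  have "wd (inv g \<otimes> (g \<otimes> x)) (inv g \<otimes> (g \<otimes> y)) \<le> wd (g \<otimes> x) (g \<otimes> y)"
    using assms by (intro wd_translate_le) auto
  then show ?thesis
    using wd_translate_le[OF assms] assms by (simp add: m_assoc[symmetric])
qed

lemma wd_eq_wd_one:
  assumes "x \<in> carrier G" "y \<in> carrier G"
  shows "wd x y = wd \<one> (inv x \<otimes> y)"
  using wd_translate[of x y "inv x"] assms by simp

lemma finite_sphere_relpow: "finite {y. (x, y) \<in> edges ^^ n}"
proof (induction n)
  case (Suc n)
  have "{y. (x, y) \<in> edges ^^ Suc n} \<subseteq> (\<lambda>(z, a). z \<otimes> a) ` ({z. (x, z) \<in> edges ^^ n} \<times> letters)"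
    by (force simp: edges_iff simp del: Un_iff)
  then show ?case
    using Suc finite_letters by (meson finite_SigmaI finite_imageI finite_subset)
qed simp

lemma finite_wd_ball:
  assumes "x \<in> carrier G"
  shows "finite {y \<in> carrier G. wd x y \<le> R}"
proof -
  have "{y \<in> carrier G. wd x y \<le> R} \<subseteq> (\<Union>n\<le>nat \<lfloor>R\<rfloor>. {y. (x, y) \<in> edges ^^ n})"
  proof
    fix y assume "y \<in> {y \<in> carrier G. wd x y \<le> R}"
    moreover from this obtain n where "(x, y) \<in> edges ^^ n" "wd x y = real n"
      using wd_attained assms by blast
    ultimately show "y \<in> (\<Union>n\<le>nat \<lfloor>R\<rfloor>. {y. (x, y) \<in> edges ^^ n})"
      by (auto simp: le_nat_floor)
  qed
  then show ?thesis
    using finite_sphere_relpow by (meson finite_UN_I finite_atMost finite_subset)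
qed

text \<open>By left invariance \<open>wd x y\<close> depends only on
  \<open>inv x \<otimes> y\<close>. Properness of maps into the tree is verified in this
  form.\<close>

lemma wd_bounded_if_finite_quotients:
  assumes "finite Z" "Z \<subseteq> carrier G"
  obtains C where "\<And>x y. x \<in> carrier G \<Longrightarrow> y \<in> carrier G \<Longrightarrow> inv x \<otimes> y \<in> Z \<Longrightarrow> wd x y \<le> C"
proof
  fix x y assume "x \<in> carrier G" "y \<in> carrier G" "inv x \<otimes> y \<in> Z"
  then show "wd x y \<le> Max (wd \<one> ` Z)"
    using assms wd_eq_wd_one[of x y] by simp
qed

text \<open>The two pieces of a shortest path bound the distances from \<open>s i\<close> to its
  ends by \<open>i\<close> and \<open>n - i\<close>; these add up to \<open>n\<close>, so the
  triangle inequality makes both bounds exact.\<close>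

lemma geodesic:
  assumes "x \<in> carrier G" "y \<in> carrier G"
  obtains n s where "s 0 = x" "s n = y" "\<And>i. i < n \<Longrightarrow> (s i, s (Suc i)) \<in> edges"
    "\<And>i. i \<le> n \<Longrightarrow> s i \<in> carrier G" "\<And>i. i \<le> n \<Longrightarrow> wd x (s i) = real i"
    "\<And>i. i \<le> n \<Longrightarrow> wd (s i) y = real (n - i)" "wd x y = real n"
proof -
  obtain n where n: "(x, y) \<in> edges ^^ n" "wd x y = real n"
    using wd_attained assms by blast
  then obtain s where s: "s 0 = x" "s n = y" "\<forall>i<n. (s i, s (Suc i)) \<in> edges"
    unfolding relpow_fun_conv by blast
  have *: "(s i, s (i + k)) \<in> edges ^^ k" if "i + k \<le> n" for i k
    using that s(3) unfolding relpow_fun_conv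
    by (intro exI[of _ "\<lambda>j. s (i + j)"]) auto
  have in_G: "s i \<in> carrier G" if "i \<le> n" for i
    using *[of 0 i] that s(1) assms(1) relpow_edges_closed by auto
  have "wd x (s i) \<le> real i" "wd (s i) y \<le> real (n - i)" if "i \<le> n" for i
    using wd_le[OF *[of 0 i]] wd_le[OF *[of i "n - i"]] that s(1,2) by auto
  moreover have "real n \<le> wd x (s i) + wd (s i) y" if "i \<le> n" for i
    using wd_triangle[of x "s i" y] that in_G assms n(2) by simp
  ultimately have "wd x (s i) = real i" "wd (s i) y = real (n - i)" if "i \<le> n" for i
    using that by (smt (verit) of_nat_diff)+
  then show ?thesis
    using that s in_G n(2) by blast
qed

abbreviation gp :: "'a \<Rightarrow> 'a \<Rightarrow> 'a \<Rightarrow> real" where "gp \<equiv> gromov_product G A"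

lemma gp_nonneg:
  assumes "p \<in> carrier G" "g \<in> carrier G" "h \<in> carrier G"
  shows "gp p g h \<ge> 0"
  unfolding gromov_product_def using wd_triangle[of g p h] wd_sym[of g p] assms by simp

section \<open>Coarse embeddings into the tree of words\<close>

text \<open>The first clause is the coarse Lipschitz property, phrased through right translations.
  It is asked of every \<open>k\<close>, not only of letters, so that it survives composition with
  an endomorphism, which turns \<open>k\<close> into \<open>\<phi> k\<close>. The second clause is
  uniform properness.\<close>

definition coarse_embedding :: "('a \<Rightarrow> 'l list) \<Rightarrow> bool"
  where "coarse_embedding \<psi> \<longleftrightarrow>
    (\<forall>k\<in>carrier G. \<exists>D. \<forall>x\<in>carrier G. close D (\<psi> x) (\<psi> (x \<otimes> k))) \<and>
    (\<forall>R. \<exists>C. \<forall>x\<in>carrier G. \<forall>y\<in>carrier G. close R (\<psi> x) (\<psi> y) \<longrightarrow> wd x y \<le> C)"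

text \<open>As there are finitely many letters, one constant serves all edges. The free lower bound
  \<open>D\<^sub>0\<close> lets \<open>D\<close> also absorb the length of
  \<open>\<psi> p\<close>.\<close>

lemma coarse_embedding_edges:
  assumes "coarse_embedding \<psi>"
  obtains D where "D \<ge> D\<^sub>0" "\<And>x y. (x, y) \<in> edges \<Longrightarrow> close D (\<psi> x) (\<psi> y)"
proof -
  have "\<forall>a\<in>letters. \<exists>D. \<forall>x\<in>carrier G. close D (\<psi> x) (\<psi> (x \<otimes> a))"
    using assms letters_closed unfolding coarse_embedding_def by blast
  then obtain D where D: "\<And>a x. a \<in> letters \<Longrightarrow> x \<in> carrier G \<Longrightarrow> close (D a) (\<psi> x) (\<psi> (x \<otimes> a))"
    by metis
  show ?thesis
  proof (rule that[of "D\<^sub>0 + sum D letters"])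
    fix x y assume "(x, y) \<in> edges"
    then obtain a where a: "x \<in> carrier G" "a \<in> letters" "y = x \<otimes> a"
      using edges_iff by blast
    then have "D a \<le> D\<^sub>0 + sum D letters"
      using finite_letters member_le_sum[of a letters D] by (simp del: Un_iff)
    then show "close (D\<^sub>0 + sum D letters) (\<psi> x) (\<psi> y)"
      using D a close_mono by blast
  qed simp
qed

lemma coarse_embedding_proper:
  assumes "coarse_embedding \<psi>"
  obtains C where "C \<ge> 0"
    "\<And>x y. x \<in> carrier G \<Longrightarrow> y \<in> carrier G \<Longrightarrow> close R (\<psi> x) (\<psi> y) \<Longrightarrow> wd x y \<le> C"
proof -
  obtain C where C: "\<forall>x\<in>carrier G. \<forall>y\<in>carrier G. close R (\<psi> x) (\<psi> y) \<longrightarrow> wd x y \<le> C"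
    using assms unfolding coarse_embedding_def by blast
  show ?thesis
    by (rule that[of "max C 0"]) (use C in \<open>force\<close>)+
qed

text \<open>The image of a geodesic from \<open>p\<close> to \<open>g\<close> is a chain of words
  ending at \<open>\<psi> g\<close>, so it has to pass near each prefix \<open>c\<close>. The
  additive distances record that \<open>x\<close> lies on this geodesic.\<close>

lemma coarse_embedding_geodesic_near_prefix:
  assumes edge: "\<And>x y. (x, y) \<in> edges \<Longrightarrow> close D (\<psi> x) (\<psi> y)"
    and D: "length (\<psi> p) \<le> D"
    and in_G: "p \<in> carrier G" "g \<in> carrier G" and "prefix c (\<psi> g)"
  obtains x u where "x \<in> carrier G" "\<psi> x = c @ u" "length u \<le> D" "wd p g = wd p x + wd x g"
proof -
  obtain n s where s: "s 0 = p" "s n = g" "\<And>i. i < n \<Longrightarrow> (s i, s (Suc i)) \<in> edges"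
    "\<And>i. i \<le> n \<Longrightarrow> s i \<in> carrier G" "\<And>i. i \<le> n \<Longrightarrow> wd p (s i) = real i"
    "\<And>i. i \<le> n \<Longrightarrow> wd (s i) g = real (n - i)" "wd p g = real n"
    using geodesic[OF in_G] by metis
  obtain i u where "i \<le> n" "\<psi> (s i) = c @ u" "length u \<le> D"
    using chain_near_prefix[of n D "\<lambda>i. \<psi> (s i)" c] s(1-3) edge D assms(5) by auto
  then show ?thesis
    using that[of "s i" u] s by (simp add: of_nat_diff)
qed

text \<open>The vertices of the tree
  geodesic from \<open>\<psi> p\<close> to \<open>\<psi> g\<close> are followed by points of \<open>G\<close>, and successive ones are at bounded
  distance.\<close>

lemma coarse_embedding_linear:
  assumes "coarse_embedding \<psi>" "p \<in> carrier G"
  obtains C where "C \<ge> 0" "\<And>g. g \<in> carrier G \<Longrightarrow> wd p g \<le> C * (real (length (\<psi> g)) + 1)"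
proof -
  obtain D where D: "D \<ge> length (\<psi> p)" "\<And>x y. (x, y) \<in> edges \<Longrightarrow> close D (\<psi> x) (\<psi> y)"
    using coarse_embedding_edges[OF assms(1)] by metis
  \<comment> \<open>Points near two successive prefixes have images at most
    \<open>D + (D + 1)\<close> apart in the tree; properness turns this into one step of size
    \<open>C\<close> in \<open>G\<close>.\<close>
  obtain C where C: "C \<ge> 0"
    "\<And>x y. x \<in> carrier G \<Longrightarrow> y \<in> carrier G \<Longrightarrow> close (2 * D + 1) (\<psi> x) (\<psi> y) \<Longrightarrow> wd x y \<le> C"
    using coarse_embedding_proper[OF assms(1)] by metis
  show ?thesis
  proof (rule that[OF C(1)])
    fix g assume g: "g \<in> carrier G"
    \<comment> \<open>Induction along the prefixes of \<open>\<psi> g\<close>: a point whose image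
      exceeds the prefix of length \<open>j\<close> by at most \<open>D\<close> letters is reached
      from \<open>p\<close> in \<open>j + 1\<close> steps of size \<open>C\<close>.\<close>
    have "wd p x \<le> C * (real j + 1)"
      if "j \<le> length (\<psi> g)" "x \<in> carrier G" "\<psi> x = take j (\<psi> g) @ u" "length u \<le> D" for j x u
      using that
    proof (induction j arbitrary: x u)
      case 0
      then have "close (2 * D + 1) (\<psi> p) (\<psi> x)"
        using D(1) by (intro closeI[of _ "[]" "\<psi> p" _ "\<psi> x"]) auto
      then show ?case
        using C(2) 0 assms(2) by simp
    next
      case (Suc j)
      obtain y v where y: "y \<in> carrier G" "\<psi> y = take j (\<psi> g) @ v" "length v \<le> D"
        using coarse_embedding_geodesic_near_prefix[where \<psi> = \<psi> and D = D, OF D(2,1) assms(2) g take_is_prefix] by metis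
      have "\<psi> x = take j (\<psi> g) @ (\<psi> g ! j # u)"
        using Suc.prems by (simp add: take_Suc_conv_app_nth)
      then have "close (2 * D + 1) (\<psi> y) (\<psi> x)"
        using y Suc.prems by (intro closeI[of _ "take j (\<psi> g)" v _ "\<psi> g ! j # u"]) auto
      then have "wd y x \<le> C"
        using C(2) y(1) Suc.prems by blast
      moreover have "wd p y \<le> C * (real j + 1)"
        using Suc y by simp
      ultimately show ?case
        using wd_triangle[of p y x] assms(2) y(1) Suc.prems(2) by (simp add: algebra_simps)
    qed
    from this[of "length (\<psi> g)" g "[]"] show "wd p g \<le> C * (real (length (\<psi> g)) + 1)"
      using g by simp
  qed
qed

text \<open>A geodesic from \<open>g\<close> to \<open>h\<close> passes near the branch point
  \<open>c\<close> of their images. Every point on it is at least \<open>gp p g h\<close> away from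
  \<open>p\<close>, and the linear bound estimates that distance by \<open>length c\<close>.\<close>

lemma gp_le_common_prefix:
  assumes "coarse_embedding \<psi>" "p \<in> carrier G"
  obtains C where "C \<ge> 0" "\<And>g h. g \<in> carrier G \<Longrightarrow> h \<in> carrier G \<Longrightarrow>
    \<exists>c. prefix c (\<psi> g) \<and> prefix c (\<psi> h) \<and> gp p g h \<le> C * (real (length c) + 1)"
proof -
  obtain D where D: "\<And>x y. (x, y) \<in> edges \<Longrightarrow> close D (\<psi> x) (\<psi> y)"
    using coarse_embedding_edges[OF assms(1)] by metis
  obtain C where C: "C \<ge> 0" "\<And>g. g \<in> carrier G \<Longrightarrow> wd p g \<le> C * (real (length (\<psi> g)) + 1)"
    using coarse_embedding_linear[OF assms] by metis
  show ?thesis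
  proof (rule that[of "C * (real D + 1)"])
    fix g h assume gh: "g \<in> carrier G" "h \<in> carrier G"
    obtain n s where s: "s 0 = g" "s n = h" "\<And>i. i < n \<Longrightarrow> (s i, s (Suc i)) \<in> edges"
      "\<And>i. i \<le> n \<Longrightarrow> s i \<in> carrier G" "\<And>i. i \<le> n \<Longrightarrow> wd g (s i) = real i"
      "\<And>i. i \<le> n \<Longrightarrow> wd (s i) h = real (n - i)" "wd g h = real n"
      using geodesic[OF gh] by metis
    obtain c i u where c: "prefix c (\<psi> g)" "prefix c (\<psi> h)" "i \<le> n" "\<psi> (s i) = c @ u" "length u \<le> D"
      using chain_near_branch_point[of n D "\<lambda>i. \<psi> (s i)"] s(1-3) D by metis
    have "wd p g \<le> wd p (s i) + real i"
      using wd_triangle[of p "s i" g] wd_sym[of "s i" g] s(4,5) c(3) gh assms(2) by simp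
    moreover have "wd p h \<le> wd p (s i) + (real n - real i)"
      using wd_triangle[of p "s i" h] s(4,6) c(3) gh assms(2) by (simp add: of_nat_diff)
    ultimately have "gp p g h \<le> wd p (s i)"
      unfolding gromov_product_def using s(7) by simp
    also have "\<dots> \<le> C * (real (length c + length u) + 1)"
      using C(2)[of "s i"] c(3,4) s(4) by simp
    \<comment> \<open>The remainder \<open>u\<close> beyond \<open>c\<close> has at most
      \<open>D\<close> letters, which the factor \<open>D + 1\<close> absorbs.\<close>
    also have "\<dots> \<le> C * ((real D + 1) * (real (length c) + 1))"
    proof (rule mult_left_mono[OF _ C(1)])
      have "real (length u) \<le> real D" "0 \<le> real D * real (length c)"
        using c(5) by auto
      then show "real (length c + length u) + 1 \<le> (real D + 1) * (real (length c) + 1)"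
        unfolding ring_distribs of_nat_add by linarith
    qed
    finally show "\<exists>c. prefix c (\<psi> g) \<and> prefix c (\<psi> h) \<and>
        gp p g h \<le> C * (real D + 1) * (real (length c) + 1)"
      using c(1,2) by (auto simp: mult.assoc)
  qed (use C(1) in simp)
qed

text \<open>The geodesics from \<open>p\<close> to \<open>g\<close> and to \<open>h\<close> both
  pass near \<open>c\<close>, at points \<open>x\<close> and \<open>y\<close> that properness keeps
  close together. So \<open>gp p g h\<close> is, up to a constant, at least the mean of
  \<open>wd p x\<close> and \<open>wd p y\<close>, and both of these are large when \<open>c\<close>
  is long.\<close>

lemma common_prefix_le_gp:
  assumes "coarse_embedding \<psi>" "p \<in> carrier G"
  obtains C where "C \<ge> 0" "\<And>g h c. g \<in> carrier G \<Longrightarrow> h \<in> carrier G \<Longrightarrow>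
    prefix c (\<psi> g) \<Longrightarrow> prefix c (\<psi> h) \<Longrightarrow> real (length c) \<le> C * (gp p g h + 1)"
proof -
  obtain D where D: "D \<ge> length (\<psi> p)" "\<And>x y. (x, y) \<in> edges \<Longrightarrow> close D (\<psi> x) (\<psi> y)"
    using coarse_embedding_edges[OF assms(1)] by metis
  obtain C where C: "C \<ge> 0"
    "\<And>x y. x \<in> carrier G \<Longrightarrow> y \<in> carrier G \<Longrightarrow> close (2 * D) (\<psi> x) (\<psi> y) \<Longrightarrow> wd x y \<le> C"
    using coarse_embedding_proper[OF assms(1)] by metis
  \<comment> \<open>Along a path from \<open>p\<close> the image starts with at most
    \<open>D\<close> letters and gains at most \<open>D\<close> per edge.\<close>
  have length_le: "real (length (\<psi> x)) \<le> real D * (wd p x + 1)" if x: "x \<in> carrier G" for x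
  proof -
    have "length (\<psi> y) \<le> D + D * n" if "(p, y) \<in> edges ^^ n" for y n
      using that
    proof (induction n arbitrary: y)
      case (Suc n)
      then obtain z where z: "(p, z) \<in> edges ^^ n" "(z, y) \<in> edges"
        by auto
      then show ?case
        using Suc.IH[OF z(1)] close_length[OF D(2)[OF z(2)]] by simp
    qed (use D(1) in simp)
    then obtain n where "length (\<psi> x) \<le> D + D * n" "wd p x = real n"
      using wd_attained[OF assms(2) x] by metis
    then have "real (length (\<psi> x)) \<le> real (D + D * n)" "wd p x = real n"
      by (simp_all only: of_nat_le_iff)
    then show ?thesis
      by (simp add: algebra_simps)
  qed
  show ?thesis
  proof (rule that[of "real D * (C + 1)"])
    fix g h c
    assume gh: "g \<in> carrier G" "h \<in> carrier G" and c: "prefix c (\<psi> g)" "prefix c (\<psi> h)"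
    obtain x u where x: "x \<in> carrier G" "\<psi> x = c @ u" "length u \<le> D" "wd p g = wd p x + wd x g"
      using coarse_embedding_geodesic_near_prefix[where \<psi> = \<psi> and D = D, OF D(2,1) assms(2) gh(1) c(1)] by metis
    obtain y v where y: "y \<in> carrier G" "\<psi> y = c @ v" "length v \<le> D" "wd p h = wd p y + wd y h"
      using coarse_embedding_geodesic_near_prefix[where \<psi> = \<psi> and D = D, OF D(2,1) assms(2) gh(2) c(2)] by metis
    have "wd x y \<le> C"
      using x(1-3) y(1-3) by (intro C(2) closeI[of _ c u _ v]) auto
    moreover have "wd g h \<le> wd x g + wd x y + wd y h"
      using wd_triangle[of g x h] wd_triangle[of x y h] wd_sym[of g x] gh x(1) y(1) by simp
    moreover have "2 * gp p g h = wd p g + wd p h - wd g h"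
      by (simp add: gromov_product_def)
    ultimately have *: "wd p x + wd p y \<le> 2 * gp p g h + C"
      using x(4) y(4) by linarith
    have "2 * real (length c) \<le> real D * (wd p x + 1) + real D * (wd p y + 1)"
      using length_le[OF x(1)] length_le[OF y(1)] x(2) y(2) by simp
    also have "\<dots> = real D * (wd p x + wd p y + 2)"
      by (simp add: algebra_simps)
    also have "\<dots> \<le> real D * (2 * ((C + 1) * (gp p g h + 1)))"
    proof (rule mult_left_mono)
      have "0 \<le> C * gp p g h"
        using C(1) gp_nonneg[OF assms(2) gh] by simp
      then show "wd p x + wd p y + 2 \<le> 2 * ((C + 1) * (gp p g h + 1))"
        unfolding ring_distribs using * C(1) by linarith
    qed simp
    also have "\<dots> = 2 * (real D * (C + 1) * (gp p g h + 1))"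
      by (simp only: ac_simps)
    finally show "real (length c) \<le> real D * (C + 1) * (gp p g h + 1)"
      by (simp only: mult_le_cancel_left_pos zero_less_numeral)
  qed (use C(1) in simp)
qed

text \<open>The Lipschitz clause for \<open>k\<close> is that of \<open>f\<close> for
  \<open>\<phi> k\<close>. For properness, \<open>\<phi> (inv x \<otimes> y)\<close> lies in a
  finite ball; as the fibres of \<open>\<phi>\<close> are empty or cosets of the finite kernel, only
  finitely many quotients \<open>inv x \<otimes> y\<close> remain.\<close>

lemma coarse_embedding_comp_hom:
  assumes f: "coarse_embedding f" and hom: "\<phi> \<in> hom G G" and fin: "finite (kernel G G \<phi>)"
  shows "coarse_embedding (f \<circ> \<phi>)"
  unfolding coarse_embedding_def
proof (intro conjI ballI allI)
  interpret group_hom G G \<phi>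
    using hom by (simp add: group_hom.intro group_hom_axioms_def is_group)
  fix k assume k: "k \<in> carrier G"
  then obtain D where "\<forall>x\<in>carrier G. close D (f x) (f (x \<otimes> \<phi> k))"
    using f hom_closed unfolding coarse_embedding_def by blast
  then show "\<exists>D. \<forall>x\<in>carrier G. close D ((f \<circ> \<phi>) x) ((f \<circ> \<phi>) (x \<otimes> k))"
    using k by (intro exI[of _ D]) simp
next
  interpret group_hom G G \<phi>
    using hom by (simp add: group_hom.intro group_hom_axioms_def is_group)
  fix R
  obtain C where C:
    "\<And>x y. x \<in> carrier G \<Longrightarrow> y \<in> carrier G \<Longrightarrow> close R (f x) (f y) \<Longrightarrow> wd x y \<le> C"
    using coarse_embedding_proper[OF f] by metis
  let ?Z = "{z \<in> carrier G. wd \<one> (\<phi> z) \<le> C}"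
  have fibre: "finite (\<phi> -` {y} \<inter> carrier G)" for y
  proof (cases "\<exists>z\<in>carrier G. \<phi> z = y")
    case True
    then obtain z where z: "z \<in> carrier G" "\<phi> z = y"
      by blast
    have "\<phi> -` {y} \<inter> carrier G \<subseteq> (\<lambda>k. z \<otimes> k) ` kernel G G \<phi>"
    proof
      fix z' assume "z' \<in> \<phi> -` {y} \<inter> carrier G"
      then have z': "z' \<in> carrier G" "\<phi> z' = y"
        by auto
      then have "inv z \<otimes> z' \<in> kernel G G \<phi>" "z' = z \<otimes> (inv z \<otimes> z')"
        using z by (auto simp: kernel_def m_assoc[symmetric])
      then show "z' \<in> (\<lambda>k. z \<otimes> k) ` kernel G G \<phi>"
        by blast
    qed
    then show ?thesis
      using fin by (meson finite_imageI finite_subset)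
  next
    case False
    then have "\<phi> -` {y} \<inter> carrier G = {}"
      by blast
    then show ?thesis
      by simp
  qed
  have "finite {y \<in> carrier G. wd \<one> y \<le> C}"
    by (rule finite_wd_ball) simp
  then have "finite (\<phi> -` {y \<in> carrier G. wd \<one> y \<le> C} \<inter> carrier G)"
    by (rule finite_finite_vimage_IntI) (rule fibre)
  moreover have "?Z \<subseteq> \<phi> -` {y \<in> carrier G. wd \<one> y \<le> C} \<inter> carrier G"
    by auto
  ultimately have "finite ?Z"
    using finite_subset by blast
  then obtain C' where C':
    "\<And>x y. x \<in> carrier G \<Longrightarrow> y \<in> carrier G \<Longrightarrow> inv x \<otimes> y \<in> ?Z \<Longrightarrow> wd x y \<le> C'"
    using wd_bounded_if_finite_quotients[of ?Z] by blast
  have "wd x y \<le> C'"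
    if xy: "x \<in> carrier G" "y \<in> carrier G" "close R ((f \<circ> \<phi>) x) ((f \<circ> \<phi>) y)" for x y
  proof -
    have "wd (\<phi> x) (\<phi> y) \<le> C"
      using C xy by simp
    then have "wd \<one> (\<phi> (inv x \<otimes> y)) \<le> C"
      using xy wd_eq_wd_one[of "\<phi> x" "\<phi> y"] by simp
    then show ?thesis
      using C' xy by simp
  qed
  then show "\<exists>C. \<forall>x\<in>carrier G. \<forall>y\<in>carrier G.
      close R ((f \<circ> \<phi>) x) ((f \<circ> \<phi>) y) \<longrightarrow> wd x y \<le> C"
    by blast
qed

lemma gp_hom_lower_bound:
  assumes f: "coarse_embedding f" and hom: "\<phi> \<in> hom G G" and fin: "finite (kernel G G \<phi>)"
    and p: "p \<in> carrier G"
  shows "\<exists>P>0. \<exists>Q. \<forall>g\<in>carrier G. \<forall>h\<in>carrier G. P * gp p (\<phi> g) (\<phi> h) + Q \<ge> gp p g h"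
proof -
  obtain C where C: "C \<ge> 0" "\<And>g h. g \<in> carrier G \<Longrightarrow> h \<in> carrier G \<Longrightarrow>
      \<exists>c. prefix c ((f \<circ> \<phi>) g) \<and> prefix c ((f \<circ> \<phi>) h) \<and> gp p g h \<le> C * (real (length c) + 1)"
    using gp_le_common_prefix[OF coarse_embedding_comp_hom[OF f hom fin] p] by metis
  obtain C' where C': "C' \<ge> 0" "\<And>g h c. g \<in> carrier G \<Longrightarrow> h \<in> carrier G \<Longrightarrow>
      prefix c (f g) \<Longrightarrow> prefix c (f h) \<Longrightarrow> real (length c) \<le> C' * (gp p g h + 1)"
    using common_prefix_le_gp[OF f p] by metis
  \<comment> \<open>The summand \<open>1\<close> keeps the factor positive even when
    \<open>C\<close> or \<open>C'\<close> vanishes; it costs nothing since Gromov products are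
    nonnegative.\<close>
  have "gp p g h \<le> (C * C' + 1) * gp p (\<phi> g) (\<phi> h) + C * (C' + 1)"
    if gh: "g \<in> carrier G" "h \<in> carrier G" for g h
  proof -
    have im: "\<phi> g \<in> carrier G" "\<phi> h \<in> carrier G"
      using hom gh by (auto simp: hom_def)
    obtain c where c: "prefix c (f (\<phi> g))" "prefix c (f (\<phi> h))"
      "gp p g h \<le> C * (real (length c) + 1)"
      using C(2)[OF gh] by auto
    note c(3)
    also have "C * (real (length c) + 1) \<le> C * (C' * (gp p (\<phi> g) (\<phi> h) + 1) + 1)"
      using C'(2)[OF im c(1,2)] C(1) by (intro mult_left_mono) auto
    also have "\<dots> \<le> (C * C' + 1) * gp p (\<phi> g) (\<phi> h) + C * (C' + 1)"
      using gp_nonneg[OF p im] by (simp add: algebra_simps)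
    finally show ?thesis .
  qed
  moreover have "C * C' + 1 > 0"
    using C(1) C'(1) by (simp add: add_nonneg_pos)
  ultimately show ?thesis
    by blast
qed

section \<open>Virtually free groups embed coarsely into a tree\<close>

lemma word_value_closed:
  assumes "X \<subseteq> carrier G" "w \<in> words_over X"
  shows "word_value G w \<in> carrier G"
  using assms(2) unfolding words_over_def
proof (induction w)
  case (Cons l w)
  then show ?case
    using assms(1) by (cases l) auto
qed simp

lemma word_value_append:
  assumes "X \<subseteq> carrier G" "u \<in> words_over X" "v \<in> words_over X"
  shows "word_value G (u @ v) = word_value G u \<otimes> word_value G v"
  using assms(2) unfolding words_over_def
proof (induction u)
  case Nil
  then show ?case
    using word_value_closed[OF assms(1,3)] by simp
next
  case (Cons l u)
  have "word_value G u \<in> carrier G"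
    using word_value_closed[OF assms(1)] Cons unfolding words_over_def by auto
  then show ?case
    using Cons assms(1) word_value_closed[OF assms(1,3)] by (cases l) (auto simp: m_assoc subset_iff)
qed

lemma word_value_subgroup:
  assumes "subgroup H G" "X \<subseteq> H" "w \<in> words_over X"
  shows "word_value (G\<lparr>carrier := H\<rparr>) w = word_value G w"
  using assms(3) unfolding words_over_def
proof (induction w)
  case (Cons l w)
  then show ?case
    using assms(1,2) m_inv_consistent[OF assms(1)] by (cases l) auto
qed simp

end

section \<open>Normal forms in a free subgroup\<close>

locale free_subgroup = marked_group +
  fixes H X
  assumes sub: "subgroup H G" and basis: "free_basis (G\<lparr>carrier := H\<rparr>) X"
begin

lemma H_carrier: "h \<in> H \<Longrightarrow> h \<in> carrier G"
  using subgroup.mem_carrier[OF sub] .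

lemma X_subset: "X \<subseteq> H" "X \<subseteq> carrier G"
  using basis H_carrier unfolding free_basis_def by auto

definition normal_form :: "'a \<Rightarrow> (bool \<times> 'a) list"
  where "normal_form = the_inv_into {w \<in> words_over X. reduced_word w} (word_value (G\<lparr>carrier := H\<rparr>))"

lemma bij_word_value: "bij_betw (word_value (G\<lparr>carrier := H\<rparr>)) {w \<in> words_over X. reduced_word w} H"
  using basis unfolding free_basis_def by simp

lemma normal_form:
  assumes "h \<in> H"
  shows "normal_form h \<in> words_over X" "reduced_word (normal_form h)"
    "word_value G (normal_form h) = h"
proof -
  have "normal_form h \<in> {w \<in> words_over X. reduced_word w}"
    using bij_betw_the_inv_into[OF bij_word_value] assms
    unfolding normal_form_def by (meson bij_betwE)
  then show *: "normal_form h \<in> words_over X" "reduced_word (normal_form h)"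
    by auto
  have "word_value (G\<lparr>carrier := H\<rparr>) (normal_form h) = h"
    using bij_word_value assms unfolding normal_form_def by (rule f_the_inv_into_f_bij_betw)
  then show "word_value G (normal_form h) = h"
    using word_value_subgroup[OF sub X_subset(1) *(1)] by simp
qed

lemma normal_form_word_value:
  assumes "w \<in> words_over X" "reduced_word w"
  shows "normal_form (word_value G w) = w"
  using the_inv_into_f_f[OF bij_betw_imp_inj_on[OF bij_word_value], of w] assms
    word_value_subgroup[OF sub X_subset(1) assms(1)]
  unfolding normal_form_def by simp

lemma word_value_in_H:
  assumes "w \<in> words_over X"
  shows "word_value G w \<in> H"
  using assms unfolding words_over_def
proof (induction w)
  case Nil
  then show ?case
    using subgroup.one_closed[OF sub] by simp
next
  case (Cons l w)
  then show ?case
    using X_subset(1) subgroup.m_closed[OF sub] subgroup.m_inv_closed[OF sub] by (cases l) auto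
qed

text \<open>Either the last letter of the normal form cancels against the new one, or appending the
  new one keeps the word reduced. So right multiplication by a basis element or its inverse moves
  along a single edge of the tree.\<close>

lemma normal_form_mult_letter:
  assumes "h \<in> H" "x \<in> X"
  shows "normal_form (h \<otimes> word_value G [(e, x)]) = normal_form h @ [(e, x)] \<or>
    normal_form h = normal_form (h \<otimes> word_value G [(e, x)]) @ [(\<not> e, x)]"
proof -
  note wv = word_value_append[OF X_subset(2)] word_value_closed[OF X_subset(2)]
  note nf = normal_form[OF assms(1)]
  have letter: "[(b, x)] \<in> words_over X" for b
    using assms(2) unfolding words_over_def by simp
  show ?thesis
  proof (cases "\<exists>w. normal_form h = w @ [(\<not> e, x)]")
    case True
    then obtain w where w: "normal_form h = w @ [(\<not> e, x)]"
      by blast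
    then have w': "w \<in> words_over X" "reduced_word w"
      using nf(1,2) unfolding words_over_def reduced_word_def by (auto simp: successively_append_iff)
    have x: "x \<in> carrier G"
      using assms(2) X_subset(2) by blast
    have "h = word_value G w \<otimes> word_value G [(\<not> e, x)]"
      using nf(3) w wv(1)[OF w'(1) letter] by simp
    moreover have "word_value G [(\<not> e, x)] \<otimes> word_value G [(e, x)] = \<one>"
      using x by auto
    ultimately have "h \<otimes> word_value G [(e, x)] = word_value G w"
      using wv(2)[OF w'(1)] wv(2)[OF letter] by (simp only: m_assoc r_one)
    then show ?thesis
      using normal_form_word_value[OF w'] w by simp
  next
    case False
    have "reduced_word (normal_form h @ [(e, x)])"
    proof (cases "normal_form h" rule: rev_cases)
      case Nil
      then show ?thesis
        by (simp add: reduced_word_def)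
    next
      case (snoc w l)
      then have "l \<noteq> (\<not> e, x)"
        using False by blast
      then show ?thesis
        using nf(2) snoc unfolding reduced_word_def by (cases l) (auto simp: successively_append_iff)
    qed
    moreover have "normal_form h @ [(e, x)] \<in> words_over X"
      using nf(1) letter unfolding words_over_def by simp
    ultimately have "normal_form (word_value G (normal_form h @ [(e, x)])) = normal_form h @ [(e, x)]"
      by (rule normal_form_word_value[rotated])
    then show ?thesis
      using wv(1)[OF nf(1) letter] nf(3) by simp
  qed
qed

text \<open>The word \<open>v\<close> is followed letter by letter, one tree edge each. The letters
  that occur are tracked as well: \<open>X\<close> is not known to be finite, and this inclusion
  later confines all normal forms to a finite alphabet.\<close>

lemma normal_form_mult:
  assumes "h \<in> H" "v \<in> words_over X"
  shows "close (length v) (normal_form h) (normal_form (h \<otimes> word_value G v)) \<and>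
    set (normal_form (h \<otimes> word_value G v)) \<subseteq> set (normal_form h) \<union> set v"
  using assms(2)
proof (induction v rule: rev_induct)
  case Nil
  then show ?case
    using assms(1) H_carrier by (simp add: close_refl)
next
  case (snoc l v)
  obtain e x where l: "l = (e, x)"
    by (cases l)
  have v: "v \<in> words_over X" "[l] \<in> words_over X" "x \<in> X"
    using snoc.prems l unfolding words_over_def by auto
  let ?k = "h \<otimes> word_value G v"
  have k: "?k \<in> H"
    using assms(1) word_value_in_H[OF v(1)] subgroup.m_closed[OF sub] by blast
  have eq: "h \<otimes> word_value G (v @ [l]) = ?k \<otimes> word_value G [(e, x)]"
    using word_value_append[OF X_subset(2) v(1,2)] word_value_closed[OF X_subset(2) v(1)]
      word_value_closed[OF X_subset(2) v(2)] H_carrier[OF assms(1)] l by (simp only: m_assoc)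
  note IH = snoc.IH[OF v(1)]
  from normal_form_mult_letter[OF k v(3), of e] show ?case
  proof
    assume "normal_form (?k \<otimes> word_value G [(e, x)]) = normal_form ?k @ [(e, x)]"
    then show ?thesis
      using IH close_append[of "length v" "normal_form h" "normal_form ?k" l] l
      unfolding eq by auto
  next
    assume *: "normal_form ?k = normal_form (?k \<otimes> word_value G [(e, x)]) @ [(\<not> e, x)]"
    have "close (Suc (length v)) (normal_form h) (normal_form (?k \<otimes> word_value G [(e, x)]))"
      using IH * by (intro close_butlast[of _ _ _ "(\<not> e, x)"]) simp
    moreover have "set (normal_form (?k \<otimes> word_value G [(e, x)])) \<subseteq> set (normal_form ?k)"
      using * set_append by (metis Un_upper1)
    ultimately show ?thesis
      using IH unfolding eq by auto
  qed
qed

section \<open>Coset representatives and the component in the subgroup\<close>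

definition rep :: "'a \<Rightarrow> 'a"
  where "rep g = (SOME t. t \<in> H #> g)"

definition subgroup_part :: "'a \<Rightarrow> 'a"
  where "subgroup_part g = g \<otimes> inv rep g"

lemma rep:
  assumes "g \<in> carrier G"
  shows "rep g \<in> H #> g" "rep g \<in> carrier G"
proof -
  show "rep g \<in> H #> g"
    unfolding rep_def using rcos_self[OF assms sub] by (rule someI)
  then show "rep g \<in> carrier G"
    using assms H_carrier unfolding r_coset_def by auto
qed

lemma subgroup_part:
  assumes "g \<in> carrier G"
  shows "subgroup_part g \<in> H" "g = subgroup_part g \<otimes> rep g"
proof -
  obtain k where k: "k \<in> H" "rep g = k \<otimes> g"
    using rep(1)[OF assms] unfolding r_coset_def by auto
  then have "subgroup_part g = inv k"
    using assms H_carrier[OF k(1)]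
    by (simp add: subgroup_part_def inv_mult_group m_assoc[symmetric])
  then show "subgroup_part g \<in> H"
    using k(1) subgroup.m_inv_closed[OF sub] by simp
  show "g = subgroup_part g \<otimes> rep g"
    using assms rep(2) by (simp add: subgroup_part_def m_assoc)
qed

text \<open>\<open>g \<otimes> k\<close> and \<open>rep g \<otimes> k\<close> lie in the same right
  coset of \<open>H\<close>, hence share their representative. If the index is finite, right
  translation by a fixed \<open>k\<close> thus multiplies the subgroup component by one of finitely
  many elements.\<close>

lemma subgroup_part_mult:
  assumes "g \<in> carrier G" "k \<in> carrier G"
  shows "subgroup_part (g \<otimes> k) = subgroup_part g \<otimes> subgroup_part (rep g \<otimes> k)"
proof -
  note sp = subgroup_part[OF assms(1)] H_carrier[OF subgroup_part(1)[OF assms(1)]]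
  have r: "rep g \<otimes> k \<in> carrier G"
    using rep(2)[OF assms(1)] assms(2) by simp
  have gk: "g \<otimes> k = subgroup_part g \<otimes> (rep g \<otimes> k)"
    by (subst sp(2)) (simp add: m_assoc sp(3) rep(2)[OF assms(1)] assms(2))
  then have "H #> (g \<otimes> k) = (H #> subgroup_part g) #> (rep g \<otimes> k)"
    using coset_mult_assoc[OF _ sp(3) r] H_carrier by auto
  also have "H #> subgroup_part g = H"
    using coset_join2[OF sp(3) sub sp(1)] .
  \<comment> \<open>\<open>rep\<close> selects from the coset as a set, so equal cosets have equal
    representatives.\<close>
  finally have "rep (g \<otimes> k) = rep (rep g \<otimes> k)"
    unfolding rep_def by simp
  then show ?thesis
    unfolding subgroup_part_def[of "g \<otimes> k"] subgroup_part_def[of "rep g \<otimes> k"]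
    using gk sp(3) r rep(2)[OF r] by (simp add: m_assoc)
qed

text \<open>Finite index leaves finitely many factors \<open>subgroup_part (t \<otimes> k)\<close>,
  which bounds the movement in the tree. For properness, the common prefix of two words cancels in
  the quotient, and the short remainders are words over a finite alphabet.\<close>

lemma coarse_embedding_normal_form:
  assumes fin: "finite (rcosets H)"
  shows "coarse_embedding (normal_form \<circ> subgroup_part)"
proof -
  let ?f = "\<lambda>g. normal_form (subgroup_part g)"
  let ?R = "rep ` carrier G"
  have "?R \<subseteq> (\<lambda>C. SOME t. t \<in> C) ` (rcosets H)"
    unfolding rep_def RCOSETS_def by blast
  then have finR: "finite ?R"
    using fin finite_surj by blast
  have R_carrier: "t \<in> ?R \<Longrightarrow> t \<in> carrier G" for t
    using rep(2) by blast
  have mult: "close (length (?f (rep g \<otimes> k))) (?f g) (?f (g \<otimes> k))"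
    "set (?f (g \<otimes> k)) \<subseteq> set (?f g) \<union> set (?f (rep g \<otimes> k))"
    if "g \<in> carrier G" "k \<in> carrier G" for g k
  proof -
    have r: "subgroup_part (rep g \<otimes> k) \<in> H"
      using subgroup_part(1) rep(2) that by simp
    then show "close (length (?f (rep g \<otimes> k))) (?f g) (?f (g \<otimes> k))"
      "set (?f (g \<otimes> k)) \<subseteq> set (?f g) \<union> set (?f (rep g \<otimes> k))"
      using normal_form_mult[OF subgroup_part(1)[OF that(1)] normal_form(1)[OF r]]
        normal_form(3)[OF r] subgroup_part_mult[OF that] by auto
  qed
  have edge: "\<exists>D. \<forall>x\<in>carrier G. close D (?f x) (?f (x \<otimes> k))" if k: "k \<in> carrier G" for k
  proof (intro exI ballI)
    fix x assume x: "x \<in> carrier G"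
    then have "length (?f (rep x \<otimes> k)) \<le> (\<Sum>t\<in>?R. length (?f (t \<otimes> k)))"
      using member_le_sum[OF _ _ finR, of "rep x" "\<lambda>t. length (?f (t \<otimes> k))"] by simp
    then show "close (\<Sum>t\<in>?R. length (?f (t \<otimes> k))) (?f x) (?f (x \<otimes> k))"
      using mult(1)[OF x k] close_mono by blast
  qed
  \<comment> \<open>\<open>L\<close> contains the letters of the normal form at
    \<open>\<one>\<close> and those that a single generator can introduce; induction along the
    generators then catches every normal form.\<close>
  define L where "L = set (?f \<one>) \<union> (\<Union>t\<in>?R. \<Union>a\<in>letters. set (?f (t \<otimes> a)))"
  have finL: "finite L"
    unfolding L_def using finR finite_letters
    by (intro finite_Un[THEN iffD2] conjI finite_UN_I[OF finR] finite_UN_I[OF finite_letters] finite_set)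
  have L: "set (?f g) \<subseteq> L" if "g \<in> carrier G" for g
    using that
  proof (induction g rule: generators_induct)
    case one
    show ?case
      unfolding L_def by blast
  next
    case (step x a)
    then have "set (?f (rep x \<otimes> a)) \<subseteq> L"
      unfolding L_def by blast
    then show ?case
      using step mult(2)[of x a] letters_closed by blast
  qed
  have proper: "\<exists>C. \<forall>x\<in>carrier G. \<forall>y\<in>carrier G. close R (?f x) (?f y) \<longrightarrow> wd x y \<le> C" for R
  proof -
    let ?W = "{w \<in> words_over X. set w \<subseteq> L \<and> length w \<le> R}"
    \<comment> \<open>If \<open>x\<close> is the value of \<open>c @ u\<close> times
      \<open>s\<close>, and \<open>y\<close> that of \<open>c @ v\<close> times \<open>t\<close>,
      then \<open>c\<close> cancels and \<open>inv x \<otimes> y\<close> is \<open>?z\<close> at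
      \<open>(s, t, u, v)\<close>.\<close>
    let ?z = "\<lambda>(s, t, u, v). inv s \<otimes> (inv (word_value G u) \<otimes> word_value G v \<otimes> t)"
    let ?Z = "?z ` (?R \<times> ?R \<times> ?W \<times> ?W)"
    have "finite ?W"
      using finite_lists_length_le[OF finL, of R] by (rule finite_subset[rotated]) auto
    then have finZ: "finite ?Z"
      using finR by blast
    have "?Z \<subseteq> carrier G"
      using R_carrier word_value_closed[OF X_subset(2)] by auto
    then obtain C where C:
      "\<And>x y. x \<in> carrier G \<Longrightarrow> y \<in> carrier G \<Longrightarrow> inv x \<otimes> y \<in> ?Z \<Longrightarrow> wd x y \<le> C"
      using wd_bounded_if_finite_quotients[OF finZ] by blast
    have in_Z: "inv x \<otimes> y \<in> ?Z"
      if xy: "x \<in> carrier G" "y \<in> carrier G" and cl: "close R (?f x) (?f y)" for x y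
    proof -
      obtain c u v where c: "?f x = c @ u" "?f y = c @ v" "length u + length v \<le> R"
        using cl unfolding close_def by blast
      have words: "c \<in> words_over X" "u \<in> words_over X" "v \<in> words_over X"
        using normal_form(1)[OF subgroup_part(1)[OF xy(1)]]
          normal_form(1)[OF subgroup_part(1)[OF xy(2)]] c(1,2)
        unfolding words_over_def by auto
      note val = words[THEN word_value_closed[OF X_subset(2)]]
      have W: "u \<in> ?W" "v \<in> ?W"
        using words(2,3) c L[OF xy(1)] L[OF xy(2)] by auto
      have "x = word_value G c \<otimes> word_value G u \<otimes> rep x"
        using subgroup_part(2)[OF xy(1)] normal_form(3)[OF subgroup_part(1)[OF xy(1)]]
          word_value_append[OF X_subset(2) words(1,2)] c(1) by simp
      moreover have "y = word_value G c \<otimes> word_value G v \<otimes> rep y"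
        using subgroup_part(2)[OF xy(2)] normal_form(3)[OF subgroup_part(1)[OF xy(2)]]
          word_value_append[OF X_subset(2) words(1,3)] c(2) by simp
      ultimately have "inv x \<otimes> y =
          inv (word_value G c \<otimes> word_value G u \<otimes> rep x) \<otimes> (word_value G c \<otimes> word_value G v \<otimes> rep y)"
        by simp
      also have "\<dots> = ?z (rep x, rep y, u, v)"
        using val rep(2)[OF xy(1)] rep(2)[OF xy(2)]
        by (simp add: inv_mult_group m_assoc inv_solve_left')
      finally show ?thesis
        using W xy(1,2) by blast
    qed
    show ?thesis
      by (intro exI[of _ C] ballI impI C in_Z)
  qed
  show ?thesis
    unfolding coarse_embedding_def o_def using edge proper by blast
qed

end

lemma (in marked_group) virtually_free_coarse_embedding:
  assumes "virtually_free G"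
  shows "\<exists>f :: 'a \<Rightarrow> (bool \<times> 'a) list. coarse_embedding f"
proof -
  obtain H X where "subgroup H G" "finite (rcosets H)" "free_basis (G\<lparr>carrier := H\<rparr>) X"
    using assms unfolding virtually_free_def free_group_def by blast
  then interpret free_subgroup G A H X
    by (intro free_subgroup.intro free_subgroup_axioms.intro marked_group_axioms)
  show ?thesis
    using coarse_embedding_normal_form[OF \<open>finite (rcosets H)\<close>] by blast
qed

section \<open>Extension of Hoelder maps to the completion\<close>

lemma tendsto_powr_zero:
  fixes f :: "nat \<Rightarrow> real"
  assumes "f \<longlonglongrightarrow> 0" "r > 0" "\<And>n. f n \<ge> 0"
  shows "(\<lambda>n. K * f n powr r) \<longlonglongrightarrow> 0"
proof -
  have "(\<lambda>n. f n powr r) \<longlonglongrightarrow> 0 powr r"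
    using assms by (intro tendsto_powr') auto
  then have "(\<lambda>n. K * f n powr r) \<longlonglongrightarrow> K * 0"
    by (intro tendsto_intros) simp
  then show ?thesis
    by simp
qed

lemma Holder_condition_imp_uniformly_continuous_map:
  assumes "Metric_space M d" "Metric_space M' d'" "Holder_condition M d M' d' f"
  shows "uniformly_continuous_map (metric (M, d)) (metric (M', d')) f"
proof -
  interpret M: Metric_space M d by fact
  interpret M': Metric_space M' d' by fact
  obtain r K where rK: "f \<in> M \<rightarrow> M'" "r > 0" "\<And>x y. x \<in> M \<Longrightarrow> y \<in> M \<Longrightarrow> d' (f x) (f y) \<le> K * d x y powr r"
    using assms(3) unfolding Holder_condition_def by blast
  have "(\<lambda>n. d' (f (\<rho> n)) (f (\<sigma> n))) \<longlonglongrightarrow> 0"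
    if "range \<rho> \<subseteq> M" "range \<sigma> \<subseteq> M" "(\<lambda>n. d (\<rho> n) (\<sigma> n)) \<longlonglongrightarrow> 0" for \<rho> \<sigma>
  proof (rule tendsto_sandwich[OF _ _ tendsto_const])
    show "(\<lambda>n. K * d (\<rho> n) (\<sigma> n) powr r) \<longlonglongrightarrow> 0"
      using tendsto_powr_zero[OF that(3) rK(2)] by simp
    show "\<forall>\<^sub>F n in sequentially. d' (f (\<rho> n)) (f (\<sigma> n)) \<le> K * d (\<rho> n) (\<sigma> n) powr r"
      using rK(3) that(1,2) by (intro always_eventually) blast
  qed simp
  then show ?thesis
    using rK(1) by (simp add: uniformly_continuous_map_sequentially)
qed

lemma Holder_condition_imp_continuous_map:
  assumes "Metric_space M d" "Metric_space M' d'" "Holder_condition M d M' d' f"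
  shows "continuous_map (Metric_space.mtopology M d) (Metric_space.mtopology M' d') f"
  using uniformly_continuous_imp_continuous_map[OF Holder_condition_imp_uniformly_continuous_map[OF assms]]
    assms(1,2) by (simp add: Metric_space.mtopology_of)

lemma Metric_space_tendsto_dist:
  assumes "Metric_space M d"
    and "limitin (Metric_space.mtopology M d) \<sigma> x sequentially"
    and "limitin (Metric_space.mtopology M d) \<tau> y sequentially"
  shows "(\<lambda>n. d (\<sigma> n) (\<tau> n)) \<longlonglongrightarrow> d x y"
proof -
  interpret Metric_space M d by fact
  from assms(2,3) have lim: "x \<in> M" "y \<in> M" "\<forall>\<^sub>F n in sequentially. \<sigma> n \<in> M" "\<forall>\<^sub>F n in sequentially. \<tau> n \<in> M"
    "(\<lambda>n. d (\<sigma> n) x) \<longlonglongrightarrow> 0" "(\<lambda>n. d (\<tau> n) y) \<longlonglongrightarrow> 0"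
    by (auto simp: limitin_metric_dist_null)
  have "(\<lambda>n. d (\<sigma> n) (\<tau> n) - d x y) \<longlonglongrightarrow> 0"
  proof (rule Lim_null_comparison)
    show "\<forall>\<^sub>F n in sequentially. norm (d (\<sigma> n) (\<tau> n) - d x y) \<le> d (\<sigma> n) x + d (\<tau> n) y"
      using lim(3,4)
    proof eventually_elim
      case (elim n)
      then show ?case
        using triangle[of "\<sigma> n" x "\<tau> n"] triangle[of x y "\<tau> n"] triangle[of x "\<sigma> n" y]
          triangle[of "\<sigma> n" "\<tau> n" y] lim(1,2) by (simp add: commute)
    qed
    show "(\<lambda>n. d (\<sigma> n) x + d (\<tau> n) y) \<longlonglongrightarrow> 0"
      using tendsto_add[OF lim(5,6)] by simp
  qed
  then show ?thesis
    by (rule LIM_zero_cancel)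
qed

text \<open>Each \<open>x\<close> in \<open>N\<close> is the limit of a chosen sequence from
  \<open>M\<close>, whose images under \<open>\<phi>\<close> are Cauchy by the Hoelder bound;
  \<open>\<Phi> x\<close> is their limit. The bound passes to the limit with the same
  \<open>K\<close> and \<open>r\<close>.\<close>

lemma Holder_condition_extends_to_completion:
  assumes M: "Metric_space M d" and compl: "metric_completion_of M d \<iota> N e"
    and Hol: "Holder_condition M d M d \<phi>"
  shows "\<exists>\<Phi>. extends_along M \<iota> \<phi> \<Phi> \<and> Holder_condition N e N e \<Phi>"
proof -
  interpret M: Metric_space M d by fact
  interpret N: Metric_space N e
    using compl unfolding metric_completion_of_def by blast
  have compl': "N.mcomplete" "\<iota> \<in> M \<rightarrow> N" "\<And>x y. x \<in> M \<Longrightarrow> y \<in> M \<Longrightarrow> e (\<iota> x) (\<iota> y) = d x y"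
    "N.mtopology closure_of (\<iota> ` M) = N"
    using compl unfolding metric_completion_of_def by blast+
  obtain r K where rK: "\<phi> \<in> M \<rightarrow> M" "r > 0" "K > 0"
    "\<And>x y. x \<in> M \<Longrightarrow> y \<in> M \<Longrightarrow> d (\<phi> x) (\<phi> y) \<le> K * d x y powr r"
    using Hol unfolding Holder_condition_def by blast
  let ?lim = "\<lambda>\<sigma> x. limitin N.mtopology \<sigma> x sequentially"
  have "\<exists>s. range s \<subseteq> M \<and> ?lim (\<iota> \<circ> s) x" if x: "x \<in> N" for x
  proof -
    have "x \<in> N.mtopology closure_of (\<iota> ` M)"
      using x compl'(4) by simp
    then obtain \<sigma> where \<sigma>: "range \<sigma> \<subseteq> \<iota> ` M \<inter> N" "?lim \<sigma> x"
      unfolding N.closure_of_sequentially by blast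
    then have "\<forall>n. \<exists>y. y \<in> M \<and> \<sigma> n = \<iota> y"
      by blast
    then obtain s where s: "\<And>n. s n \<in> M" "\<And>n. \<sigma> n = \<iota> (s n)"
      by metis
    then have "\<sigma> = \<iota> \<circ> s"
      by auto
    then show ?thesis
      using s(1) \<sigma>(2) by blast
  qed
  then obtain S where S: "\<And>x. x \<in> N \<Longrightarrow> range (S x) \<subseteq> M" "\<And>x. x \<in> N \<Longrightarrow> ?lim (\<iota> \<circ> S x) x"
    by metis
  have S_in: "S x n \<in> M" if "x \<in> N" for x n
    using S(1)[OF that] by blast
  have "\<exists>y. ?lim (\<iota> \<circ> (\<phi> \<circ> S x)) y" if x: "x \<in> N" for x
  proof -
    have Cauchy: "N.MCauchy (\<iota> \<circ> S x)"
      using N.convergent_imp_MCauchy[OF _ S(2)[OF x]] compl'(2) S_in[OF x] by auto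
    have "N.MCauchy (\<iota> \<circ> (\<phi> \<circ> S x))"
      unfolding N.MCauchy_def
    proof (intro conjI allI impI)
      show "range (\<iota> \<circ> (\<phi> \<circ> S x)) \<subseteq> N"
        using compl'(2) rK(1) S_in[OF x] by auto
      fix \<epsilon> :: real assume \<epsilon>: "\<epsilon> > 0"
      \<comment> \<open>This is the solution of
        \<open>K * \<delta> powr r = \<epsilon>\<close>.\<close>
      define \<delta> where "\<delta> = (\<epsilon> / K) powr (1 / r)"
      have \<delta>: "\<delta> > 0" "K * \<delta> powr r = \<epsilon>"
        using \<epsilon> rK(2,3) by (simp_all add: \<delta>_def powr_powr)
      obtain n0 where n0: "\<And>n n'. n0 \<le> n \<Longrightarrow> n0 \<le> n' \<Longrightarrow> e ((\<iota> \<circ> S x) n) ((\<iota> \<circ> S x) n') < \<delta>"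
        using Cauchy \<delta>(1) unfolding N.MCauchy_def by blast
      have "e ((\<iota> \<circ> (\<phi> \<circ> S x)) n) ((\<iota> \<circ> (\<phi> \<circ> S x)) n') < \<epsilon>" if "n0 \<le> n" "n0 \<le> n'" for n n'
      proof -
        have "d (S x n) (S x n') < \<delta>"
          using n0[OF that] compl'(3) S_in[OF x] by simp
        then have "K * d (S x n) (S x n') powr r < \<epsilon>"
          using \<delta>(2) rK(2,3) powr_less_mono2[of r "d (S x n) (S x n')" \<delta>] by fastforce
        moreover have "e ((\<iota> \<circ> (\<phi> \<circ> S x)) n) ((\<iota> \<circ> (\<phi> \<circ> S x)) n') = d (\<phi> (S x n)) (\<phi> (S x n'))"
          using compl'(3) rK(1) S_in[OF x] by (simp add: Pi_iff)
        ultimately show ?thesis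
          using rK(4)[OF S_in[OF x] S_in[OF x], of n n'] by simp
      qed
      then show "\<exists>n0. \<forall>n n'. n0 \<le> n \<longrightarrow> n0 \<le> n' \<longrightarrow>
          e ((\<iota> \<circ> (\<phi> \<circ> S x)) n) ((\<iota> \<circ> (\<phi> \<circ> S x)) n') < \<epsilon>"
        by blast
    qed
    then show ?thesis
      using compl'(1) unfolding N.mcomplete_def by blast
  qed
  then obtain \<Phi> where \<Phi>: "\<And>x. x \<in> N \<Longrightarrow> ?lim (\<iota> \<circ> (\<phi> \<circ> S x)) (\<Phi> x)"
    by metis
  have \<Phi>_in: "\<Phi> x \<in> N" if "x \<in> N" for x
    using \<Phi>[OF that] by (simp add: N.limitin_metric)
  have bound: "e (\<Phi> x) (\<Phi> y) \<le> K * e x y powr r" if xy: "x \<in> N" "y \<in> N" for x y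
  proof (rule LIMSEQ_le)
    show "(\<lambda>n. e ((\<iota> \<circ> (\<phi> \<circ> S x)) n) ((\<iota> \<circ> (\<phi> \<circ> S y)) n)) \<longlonglongrightarrow> e (\<Phi> x) (\<Phi> y)"
      using Metric_space_tendsto_dist[OF N.Metric_space_axioms \<Phi>[OF xy(1)] \<Phi>[OF xy(2)]] .
    have "(\<lambda>n. e ((\<iota> \<circ> S x) n) ((\<iota> \<circ> S y) n)) \<longlonglongrightarrow> e x y"
      using Metric_space_tendsto_dist[OF N.Metric_space_axioms S(2)[OF xy(1)] S(2)[OF xy(2)]] .
    then show "(\<lambda>n. K * e ((\<iota> \<circ> S x) n) ((\<iota> \<circ> S y) n) powr r) \<longlonglongrightarrow> K * e x y powr r"
      using rK(2) by (intro tendsto_mult tendsto_const tendsto_powr') auto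
    have "e ((\<iota> \<circ> (\<phi> \<circ> S x)) n) ((\<iota> \<circ> (\<phi> \<circ> S y)) n) \<le> K * e ((\<iota> \<circ> S x) n) ((\<iota> \<circ> S y) n) powr r" for n
      using rK(4)[OF S_in[OF xy(1)] S_in[OF xy(2)], of n n] compl'(3) rK(1) S_in[OF xy(1)] S_in[OF xy(2)]
      by (simp add: Pi_iff)
    then show "\<exists>n0. \<forall>n\<ge>n0. e ((\<iota> \<circ> (\<phi> \<circ> S x)) n) ((\<iota> \<circ> (\<phi> \<circ> S y)) n) \<le>
        K * e ((\<iota> \<circ> S x) n) ((\<iota> \<circ> S y) n) powr r"
      by blast
  qed
  \<comment> \<open>The sequence chosen for \<open>\<iota> x\<close> need not be constant; the
    Hoelder bound between its members and \<open>x\<close> shows that the images still tend to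
    \<open>\<iota> (\<phi> x)\<close>, and limits are unique.\<close>
  have "\<Phi> (\<iota> x) = \<iota> (\<phi> x)" if x: "x \<in> M" for x
  proof -
    have \<iota>x: "\<iota> x \<in> N" "\<iota> (\<phi> x) \<in> N"
      using x compl'(2) rK(1) by auto
    have "(\<lambda>n. e ((\<iota> \<circ> S (\<iota> x)) n) (\<iota> x)) \<longlonglongrightarrow> 0"
      using S(2)[OF \<iota>x(1)] by (simp add: N.limitin_metric_dist_null)
    from tendsto_powr_zero[OF this rK(2), of K]
    have lim: "(\<lambda>n. K * e ((\<iota> \<circ> S (\<iota> x)) n) (\<iota> x) powr r) \<longlonglongrightarrow> 0"
      by simp
    have le: "e ((\<iota> \<circ> (\<phi> \<circ> S (\<iota> x))) n) (\<iota> (\<phi> x)) \<le> K * e ((\<iota> \<circ> S (\<iota> x)) n) (\<iota> x) powr r" for n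
      using rK(4)[OF S_in[OF \<iota>x(1)] x, of n] compl'(3) rK(1) S_in[OF \<iota>x(1)] x
      by (simp add: Pi_iff)
    have "(\<lambda>n. e ((\<iota> \<circ> (\<phi> \<circ> S (\<iota> x))) n) (\<iota> (\<phi> x))) \<longlonglongrightarrow> 0"
      by (rule tendsto_sandwich[OF always_eventually always_eventually tendsto_const lim])
        (use le in simp_all)
    then have "?lim (\<iota> \<circ> (\<phi> \<circ> S (\<iota> x))) (\<iota> (\<phi> x))"
      using \<Phi>[OF \<iota>x(1)] \<iota>x(2) by (simp add: N.limitin_metric_dist_null)
    then show ?thesis
      using \<Phi>[OF \<iota>x(1)] N.limitin_metric_unique trivial_limit_sequentially by blast
  qed
  then have "extends_along M \<iota> \<phi> \<Phi>"
    unfolding extends_along_def by blast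
  moreover have "Holder_condition N e N e \<Phi>"
    unfolding Holder_condition_def using \<Phi>_in bound rK(2,3) by blast
  ultimately show ?thesis
    by blast
qed

section \<open>Visual metrics\<close>

locale visual_metric = marked_group +
  fixes p :: 'a and \<gamma> T :: real and d :: "'a \<Rightarrow> 'a \<Rightarrow> real"
  assumes p: "p \<in> carrier G" and \<gamma>: "\<gamma> > 0" and T: "T \<ge> 1" and visual: "d \<in> visual_metrics G A p \<gamma> T"
begin

lemma Metric_space_d: "Metric_space (carrier G) d"
  using visual unfolding visual_metrics_def by blast

sublocale Metric_space "carrier G" d
  by (rule Metric_space_d)

lemma d_le:
  assumes "g \<in> carrier G" "h \<in> carrier G"
  shows "d g h \<le> T * exp (- \<gamma> * gp p g h)"
proof (cases "g = h")
  case True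
  then show ?thesis
    using assms T by simp
next
  case False
  then show ?thesis
    using visual assms unfolding visual_metrics_def visual_rho_def by auto
qed

lemma le_d:
  assumes "g \<in> carrier G" "h \<in> carrier G" "g \<noteq> h"
  shows "exp (- \<gamma> * gp p g h) \<le> T * d g h"
proof -
  have "1 / T * exp (- \<gamma> * gp p g h) \<le> d g h"
    using visual assms unfolding visual_metrics_def visual_rho_def by auto
  then show ?thesis
    using T by (simp add: field_simps)
qed

text \<open>The threshold \<open>R = - ln (\<epsilon> / T) / \<gamma>\<close> solves
  \<open>T * exp (- \<gamma> * R) = \<epsilon>\<close>.\<close>

lemma d_small:
  assumes "\<epsilon> > 0"
  obtains R where "\<And>g h. g \<in> carrier G \<Longrightarrow> h \<in> carrier G \<Longrightarrow> gp p g h > R \<Longrightarrow> d g h < \<epsilon>"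
proof
  fix g h assume gh: "g \<in> carrier G" "h \<in> carrier G" and "gp p g h > - ln (\<epsilon> / T) / \<gamma>"
  then have "- \<gamma> * gp p g h < ln (\<epsilon> / T)"
    using \<gamma> by (simp add: field_simps)
  then have "exp (- \<gamma> * gp p g h) < exp (ln (\<epsilon> / T))"
    by (simp only: exp_less_cancel_iff)
  also have "\<dots> = \<epsilon> / T"
    using assms T by simp
  finally have "T * exp (- \<gamma> * gp p g h) < \<epsilon>"
    using T by (simp add: field_simps)
  then show "d g h < \<epsilon>"
    using d_le[OF gh] by simp
qed

text \<open>Truncating the geodesics from \<open>p\<close> at length \<open>n\<close> shows that the finite ball of radius \<open>n\<close> is
  a net.\<close>

lemma mtotally_bounded_carrier: "mtotally_bounded (carrier G)"
  unfolding mtotally_bounded_def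
proof (intro allI impI)
  fix \<epsilon> :: real assume "\<epsilon> > 0"
  then obtain R where R: "\<And>g h. g \<in> carrier G \<Longrightarrow> h \<in> carrier G \<Longrightarrow> gp p g h > R \<Longrightarrow> d g h < \<epsilon>"
    using d_small by metis
  obtain n :: nat where n: "real n > R"
    using reals_Archimedean2 by blast
  let ?K = "{g \<in> carrier G. wd p g \<le> real n}"
  have "\<exists>h\<in>?K. g \<in> mball h \<epsilon>" if g: "g \<in> carrier G" for g
  proof (cases "wd p g \<le> real n")
    case True
    then show ?thesis
      using g \<open>\<epsilon> > 0\<close> by (intro bexI[of _ g]) auto
  next
    case False
    obtain m s where s: "s 0 = p" "s m = g" "\<And>i. i < m \<Longrightarrow> (s i, s (Suc i)) \<in> edges"
      "\<And>i. i \<le> m \<Longrightarrow> s i \<in> carrier G" "\<And>i. i \<le> m \<Longrightarrow> wd p (s i) = real i"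
      "\<And>i. i \<le> m \<Longrightarrow> wd (s i) g = real (m - i)" "wd p g = real m"
      using geodesic[OF p g] by metis
    have "n \<le> m"
      using False s(7) by simp
    \<comment> \<open>A point on a geodesic from \<open>p\<close> to \<open>g\<close> has Gromov
      product with \<open>g\<close> equal to its distance from \<open>p\<close>.\<close>
    then have "gp p (s n) g = real n"
      unfolding gromov_product_def using s(5-7) by (simp add: of_nat_diff)
    then have "d (s n) g < \<epsilon>"
      using R[OF s(4)[OF \<open>n \<le> m\<close>] g] n by simp
    then show ?thesis
      using s(4,5)[OF \<open>n \<le> m\<close>] g by (intro bexI[of _ "s n"]) auto
  qed
  then show "\<exists>K. finite K \<and> K \<subseteq> carrier G \<and> carrier G \<subseteq> (\<Union>x\<in>K. mball x \<epsilon>)"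
    using finite_wd_ball[OF p, of "real n"] by (intro exI[of _ ?K]) blast
qed

text \<open>An injective sequence leaves every finite ball, while \<open>s n\<close> and
  \<open>s n \<otimes> k\<close> stay at word distance \<open>wd \<one> k\<close>. So their Gromov
  product is at least \<open>wd p (s n) - wd \<one> k\<close>, which tends to infinity.\<close>

lemma d_right_translate_tendsto:
  fixes s :: "nat \<Rightarrow> 'a"
  assumes "inj s" "range s \<subseteq> carrier G" "k \<in> carrier G"
  shows "(\<lambda>n. d (s n) (s n \<otimes> k)) \<longlonglongrightarrow> 0"
proof (rule LIMSEQ_I)
  fix \<epsilon> :: real assume "\<epsilon> > 0"
  then obtain R where R: "\<And>g h. g \<in> carrier G \<Longrightarrow> h \<in> carrier G \<Longrightarrow> gp p g h > R \<Longrightarrow> d g h < \<epsilon>"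
    using d_small by metis
  have in_G: "s n \<in> carrier G" for n
    using assms(2) by blast
  have "finite (s -` {g \<in> carrier G. wd p g \<le> R + wd \<one> k})"
    using finite_wd_ball[OF p] assms(1) by (intro finite_vimageI)
  then obtain n0 where "\<forall>n\<in>s -` {g \<in> carrier G. wd p g \<le> R + wd \<one> k}. n < n0"
    using finite_nat_set_iff_bounded by blast
  then have far: "wd p (s n) > R + wd \<one> k" if "n \<ge> n0" for n
    using in_G[of n] that by force
  have "d (s n) (s n \<otimes> k) < \<epsilon>" if "n \<ge> n0" for n
  proof (rule R)
    have "wd (s n) (s n \<otimes> k) = wd \<one> k"
      using wd_eq_wd_one[of "s n" "s n \<otimes> k"] in_G[of n] assms(3) by (simp add: m_assoc[symmetric])
    moreover have "wd p (s n) \<le> wd p (s n \<otimes> k) + wd (s n \<otimes> k) (s n)"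
      using wd_triangle[OF p, of "s n \<otimes> k" "s n"] in_G[of n] assms(3) by simp
    moreover have "wd (s n \<otimes> k) (s n) = wd (s n) (s n \<otimes> k)"
      using wd_sym in_G[of n] assms(3) by simp
    moreover have "2 * gp p (s n) (s n \<otimes> k) = wd p (s n) + wd p (s n \<otimes> k) - wd (s n) (s n \<otimes> k)"
      by (simp add: gromov_product_def)
    ultimately show "gp p (s n) (s n \<otimes> k) > R"
      using far[OF that] by linarith
  qed (use in_G[of n] assms(3) in auto)
  then show "\<exists>n0. \<forall>n\<ge>n0. norm (d (s n) (s n \<otimes> k) - 0) < \<epsilon>"
    by auto
qed

end

section \<open>Endomorphisms and visual metrics\<close>

locale visual_endomorphism = visual_metric +
  fixes \<phi> :: "'a \<Rightarrow> 'a"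
  assumes hom: "\<phi> \<in> hom G G"
begin

sublocale endo: group_hom G G \<phi>
  using hom by (simp add: group_hom.intro group_hom_axioms_def is_group)

text \<open>Exponentiating the inequality multiplied by \<open>- \<gamma> / P\<close> turns the
  factor \<open>P\<close> into the exponent \<open>1 / P\<close>. The upper and lower visual
  estimates contribute \<open>T\<close> and \<open>T powr (1 / P)\<close> to \<open>K\<close>, and
  \<open>Q\<close> contributes \<open>exp (\<gamma> * Q / P)\<close>.\<close>

lemma Holder_condition_if_gp_bound:
  assumes "P > 0"
    and "\<And>g h. g \<in> carrier G \<Longrightarrow> h \<in> carrier G \<Longrightarrow> P * gp p (\<phi> g) (\<phi> h) + Q \<ge> gp p g h"
  shows "Holder_condition (carrier G) d (carrier G) d \<phi>"
proof -
  define K where "K = T * exp (\<gamma> * Q / P) * T powr (1 / P)"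
  have pos: "1 / P > 0" "K > 0"
    unfolding K_def using assms(1) T by auto
  have "d (\<phi> g) (\<phi> h) \<le> K * d g h powr (1 / P)"
    if gh: "g \<in> carrier G" "h \<in> carrier G" for g h
  proof (cases "\<phi> g = \<phi> h")
    case True
    then show ?thesis
      using gh pos(2) by simp
  next
    case False
    then have "g \<noteq> h"
      by blast
    have "d (\<phi> g) (\<phi> h) \<le> T * exp (- \<gamma> * gp p (\<phi> g) (\<phi> h))"
      using d_le gh by simp
    also have "\<dots> \<le> T * exp (\<gamma> * Q / P + (1 / P) * (- \<gamma> * gp p g h))"
    proof -
      have "\<gamma> * gp p g h \<le> \<gamma> * (P * gp p (\<phi> g) (\<phi> h) + Q)"
        using assms(2)[OF gh] \<gamma> by (intro mult_left_mono) auto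
      then have "- \<gamma> * gp p (\<phi> g) (\<phi> h) \<le> \<gamma> * Q / P + (1 / P) * (- \<gamma> * gp p g h)"
        using assms(1) by (simp add: field_simps)
      then show ?thesis
        using T by simp
    qed
    also have "\<dots> = T * exp (\<gamma> * Q / P) * exp (- \<gamma> * gp p g h) powr (1 / P)"
      by (simp only: exp_add) (simp add: powr_def)
    also have "\<dots> \<le> T * exp (\<gamma> * Q / P) * (T * d g h) powr (1 / P)"
      using le_d[OF gh \<open>g \<noteq> h\<close>] assms(1) T by (intro mult_left_mono powr_mono2) auto
    also have "\<dots> = K * d g h powr (1 / P)"
      unfolding K_def using T by (simp add: powr_mult)
    finally show ?thesis .
  qed
  moreover have "\<phi> \<in> carrier G \<rightarrow> carrier G"
    by simp
  ultimately show ?thesis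
    unfolding Holder_condition_def using pos by blast
qed

text \<open>Any endomorphism stretches each edge by a bounded amount, which gives the upper
  estimate. The lower one is the hypothesis at \<open>h = g\<close>, where the Gromov product
  becomes \<open>wd p g\<close>, carried over to arbitrary pairs by left translation.\<close>

lemma quasi_isometric_embedding_if_gp_bound:
  assumes "P > 0"
    and "\<And>g h. g \<in> carrier G \<Longrightarrow> h \<in> carrier G \<Longrightarrow> P * gp p (\<phi> g) (\<phi> h) + Q \<ge> gp p g h"
  shows "quasi_isometric_embedding (carrier G) wd (carrier G) wd \<phi>"
proof -
  define N where "N = (\<Sum>a\<in>letters. wd \<one> (\<phi> a))"
  have N: "N \<ge> 0"
    unfolding N_def by (simp add: sum_nonneg wd_nonneg)
  have upper: "wd (\<phi> x) (\<phi> y) \<le> N * real n" if "(x, y) \<in> edges ^^ n" "x \<in> carrier G" for x y n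
    using that
  proof (induction n arbitrary: y)
    case (Suc n)
    then obtain z where z: "(x, z) \<in> edges ^^ n" "(z, y) \<in> edges"
      by auto
    then obtain a where a: "z \<in> carrier G" "a \<in> letters" "y = z \<otimes> a"
      using edges_iff by blast
    note a_in = letters_closed[OF a(2)]
    have "wd (\<phi> z) (\<phi> y) = wd \<one> (\<phi> a)"
      using a(1,3) a_in wd_translate[of \<one> "\<phi> a" "\<phi> z"] by simp
    also have "\<dots> \<le> N"
      unfolding N_def using finite_letters a(2) wd_nonneg by (intro member_le_sum) auto
    finally have "wd (\<phi> z) (\<phi> y) \<le> N" .
    moreover have "wd (\<phi> x) (\<phi> y) \<le> wd (\<phi> x) (\<phi> z) + wd (\<phi> z) (\<phi> y)"
      using Suc.prems(2) a(1,3) a_in by (intro wd_triangle) auto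
    ultimately show ?case
      using Suc.IH[OF z(1) Suc.prems(2)] by (simp add: algebra_simps)
  qed simp
  \<comment> \<open>The cost of moving the base point between \<open>p\<close> and
    \<open>\<one>\<close>, before and after applying \<open>\<phi>\<close>, together with
    \<open>Q\<close>.\<close>
  define C where "C = wd \<one> p + P * wd p \<one> + \<bar>Q\<bar>"
  have C: "C \<ge> 0"
    unfolding C_def using assms(1) wd_nonneg by (simp add: add_nonneg_nonneg)
  have lower: "wd x y \<le> P * wd (\<phi> x) (\<phi> y) + C" if xy: "x \<in> carrier G" "y \<in> carrier G" for x y
  proof -
    let ?g = "inv x \<otimes> y"
    have g: "?g \<in> carrier G" "\<phi> ?g \<in> carrier G"
      using xy by auto
    have "wd x y = wd \<one> ?g"
      using wd_eq_wd_one xy by blast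
    also have "\<dots> \<le> wd \<one> p + wd p ?g"
      using g p by (intro wd_triangle) auto
    also have "wd p ?g \<le> P * wd p (\<phi> ?g) + Q"
      using assms(2)[OF g(1) g(1)] by (simp add: gromov_product_def)
    also have "P * wd p (\<phi> ?g) \<le> P * (wd p \<one> + wd \<one> (\<phi> ?g))"
      using g p assms(1) by (intro mult_left_mono wd_triangle) auto
    also have "wd \<one> (\<phi> ?g) = wd (\<phi> x) (\<phi> y)"
      using wd_eq_wd_one[of "\<phi> x" "\<phi> y"] xy by simp
    finally show ?thesis
      unfolding C_def by (simp add: algebra_simps)
  qed
  define L where "L = 1 + P + N"
  have L: "L \<ge> 1" "L \<ge> P" "L \<ge> N"
    unfolding L_def using assms(1) N by auto
  have "1 / L * wd x y - C \<le> wd (\<phi> x) (\<phi> y) \<and> wd (\<phi> x) (\<phi> y) \<le> L * wd x y + C"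
    if xy: "x \<in> carrier G" "y \<in> carrier G" for x y
  proof
    have "wd x y \<le> L * wd (\<phi> x) (\<phi> y) + L * C"
      using lower[OF xy] mult_right_mono[OF L(2) wd_nonneg[of "\<phi> x" "\<phi> y"]]
        mult_right_mono[OF L(1) C] by simp
    then show "1 / L * wd x y - C \<le> wd (\<phi> x) (\<phi> y)"
      using L(1) by (simp add: field_simps)
    obtain n where "(x, y) \<in> edges ^^ n" "wd x y = real n"
      using wd_attained[OF xy] by blast
    then have "wd (\<phi> x) (\<phi> y) \<le> N * wd x y"
      using upper xy(1) by simp
    also have "\<dots> \<le> L * wd x y"
      using L(3) wd_nonneg by (intro mult_right_mono)
    finally show "wd (\<phi> x) (\<phi> y) \<le> L * wd x y + C"
      using C by simp
  qed
  moreover have "\<phi> \<in> carrier G \<rightarrow> carrier G"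
    by simp
  ultimately show ?thesis
    unfolding quasi_isometric_embedding_def using L(1) C by blast
qed

text \<open>Kernel elements have image at distance \<open>0\<close> from \<open>\<one>\<close>, so
  the lower estimate confines them to the ball of radius \<open>L * K\<close>, which is
  finite.\<close>

lemma finite_kernel_if_quasi_isometric_embedding:
  assumes "quasi_isometric_embedding (carrier G) wd (carrier G) wd \<phi>"
  shows "finite (kernel G G \<phi>)"
proof -
  obtain L K where LK: "L \<ge> 1"
    "\<And>x y. x \<in> carrier G \<Longrightarrow> y \<in> carrier G \<Longrightarrow> 1 / L * wd x y - K \<le> wd (\<phi> x) (\<phi> y)"
    using assms unfolding quasi_isometric_embedding_def by blast
  have "wd \<one> x \<le> L * K" if "x \<in> kernel G G \<phi>" for x
    using LK(2)[of \<one> x] LK(1) that by (simp add: kernel_def field_simps)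
  then have "kernel G G \<phi> \<subseteq> {x \<in> carrier G. wd \<one> x \<le> L * K}"
    by (auto simp: kernel_def)
  then show ?thesis
    using finite_wd_ball[of \<one> "L * K"] finite_subset by simp
qed

text \<open>If the kernel contains distinct \<open>s 0, s 1, \<dots>\<close> and \<open>\<phi> k \<noteq> 1\<close>, then \<open>s n\<close> and \<open>s n k\<close> become
  arbitrarily close, while their images \<open>1\<close> and \<open>\<phi> k\<close> do not depend on \<open>n\<close>.\<close>

lemma infinite_kernel_sequence:
  assumes "infinite (kernel G G \<phi>)" "k \<in> carrier G"
  obtains s :: "nat \<Rightarrow> 'a" where "range s \<subseteq> carrier G" "\<And>n. \<phi> (s n) = \<one>"
    "\<And>n. \<phi> (s n \<otimes> k) = \<phi> k" "(\<lambda>n. d (s n) (s n \<otimes> k)) \<longlonglongrightarrow> 0"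
proof -
  obtain s :: "nat \<Rightarrow> 'a" where s: "inj s" "range s \<subseteq> kernel G G \<phi>"
    using infinite_countable_subset[OF assms(1)] by blast
  have in_ker: "s n \<in> carrier G" "\<phi> (s n) = \<one>" for n
    using s(2) by (auto simp: kernel_def)
  then have "range s \<subseteq> carrier G"
    by blast
  then show ?thesis
    using that[of s] d_right_translate_tendsto[OF s(1) _ assms(2)] in_ker assms(2) by simp
qed

text \<open>Along the sequence given by an infinite kernel, uniform continuity would force the
  positive constant \<open>d \<one> (\<phi> k)\<close> to tend to \<open>0\<close>.\<close>

lemma finite_kernel_if_uniformly_continuous_map:
  assumes "uniformly_continuous_map (metric (carrier G, d)) (metric (carrier G, d)) \<phi>"
    and k: "k \<in> carrier G" "\<phi> k \<noteq> \<one>"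
  shows "finite (kernel G G \<phi>)"
proof (rule ccontr)
  assume "infinite (kernel G G \<phi>)"
  then obtain s :: "nat \<Rightarrow> 'a" where s: "range s \<subseteq> carrier G" "\<And>n. \<phi> (s n) = \<one>"
    "\<And>n. \<phi> (s n \<otimes> k) = \<phi> k" "(\<lambda>n. d (s n) (s n \<otimes> k)) \<longlonglongrightarrow> 0"
    using infinite_kernel_sequence[OF _ k(1)] by metis
  have "range (\<lambda>n. s n \<otimes> k) \<subseteq> carrier G"
    using s(1) k(1) by auto
  then have "(\<lambda>n. d (\<phi> (s n)) (\<phi> (s n \<otimes> k))) \<longlonglongrightarrow> 0"
    using assms(1) s(1,4) unfolding uniformly_continuous_map_sequentially by simp
  then have "d \<one> (\<phi> k) = 0"
    using s(2,3) LIMSEQ_unique[OF tendsto_const] by simp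
  then show False
    using k by simp
qed

text \<open>Continuity controls only convergent sequences, so total boundedness is used to pick a
  subsequence of \<open>s\<close> converging to some \<open>x\<close> in the completion. The
  translates by \<open>k\<close> have the same limit, and \<open>\<Phi> x\<close> would have to be
  both \<open>\<iota> \<one>\<close> and \<open>\<iota> (\<phi> k)\<close>.\<close>

lemma finite_kernel_if_continuous_extension:
  assumes compl: "metric_completion_of (carrier G) d \<iota> N e"
    and ext: "extends_along (carrier G) \<iota> \<phi> \<Phi>"
    and cont: "continuous_map (Metric_space.mtopology N e) (Metric_space.mtopology N e) \<Phi>"
    and k: "k \<in> carrier G" "\<phi> k \<noteq> \<one>"
  shows "finite (kernel G G \<phi>)"
proof (rule ccontr)
  assume "infinite (kernel G G \<phi>)"
  then obtain s :: "nat \<Rightarrow> 'a" where s: "range s \<subseteq> carrier G" "\<And>n. \<phi> (s n) = \<one>"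
    "\<And>n. \<phi> (s n \<otimes> k) = \<phi> k" "(\<lambda>n. d (s n) (s n \<otimes> k)) \<longlonglongrightarrow> 0"
    using infinite_kernel_sequence[OF _ k(1)] by metis
  have s_in: "s n \<in> carrier G" "s n \<otimes> k \<in> carrier G" for n
    using s(1) k(1) by auto
  interpret N: Metric_space N e
    using compl unfolding metric_completion_of_def by blast
  have compl': "N.mcomplete" "\<And>x. x \<in> carrier G \<Longrightarrow> \<iota> x \<in> N"
    "\<And>x y. x \<in> carrier G \<Longrightarrow> y \<in> carrier G \<Longrightarrow> e (\<iota> x) (\<iota> y) = d x y"
    using compl unfolding metric_completion_of_def by blast+
  let ?lim = "\<lambda>\<sigma> x. limitin N.mtopology \<sigma> x sequentially"
  obtain r :: "nat \<Rightarrow> nat" where r: "strict_mono r" "MCauchy (s \<circ> r)"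
    using mtotally_bounded_carrier s(1) unfolding mtotally_bounded_sequentially by blast
  then have "N.MCauchy (\<lambda>n. \<iota> (s (r n)))"
    using compl'(2,3) s_in(1) unfolding N.MCauchy_def MCauchy_def by (auto simp: image_subset_iff)
  then obtain x where x: "?lim (\<lambda>n. \<iota> (s (r n))) x"
    using compl'(1) unfolding N.mcomplete_def by blast
  have x_in: "x \<in> N" and lim_x: "(\<lambda>n. e (\<iota> (s (r n))) x) \<longlonglongrightarrow> 0"
    using x by (auto simp: N.limitin_metric_dist_null)
  have "(\<lambda>n. d (s (r n)) (s (r n) \<otimes> k)) \<longlonglongrightarrow> 0"
    using LIMSEQ_subseq_LIMSEQ[OF s(4) r(1)] by (simp add: o_def)
  then have lim: "(\<lambda>n. d (s (r n)) (s (r n) \<otimes> k) + e (\<iota> (s (r n))) x) \<longlonglongrightarrow> 0"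
    using tendsto_add[OF _ lim_x] by fastforce
  have le: "e (\<iota> (s (r n) \<otimes> k)) x \<le> d (s (r n)) (s (r n) \<otimes> k) + e (\<iota> (s (r n))) x" for n
    using N.triangle[of "\<iota> (s (r n) \<otimes> k)" "\<iota> (s (r n))" x] compl'(2,3) s_in x_in
    by (simp add: commute)
  have "(\<lambda>n. e (\<iota> (s (r n) \<otimes> k)) x) \<longlonglongrightarrow> 0"
    by (rule tendsto_sandwich[OF always_eventually always_eventually tendsto_const lim])
      (use le in simp_all)
  then have y: "?lim (\<lambda>n. \<iota> (s (r n) \<otimes> k)) x"
    using x_in compl'(2) s_in by (simp add: N.limitin_metric_dist_null)
  have ext': "\<Phi> (\<iota> g) = \<iota> (\<phi> g)" if "g \<in> carrier G" for g
    using ext that unfolding extends_along_def by blast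
  have "?lim (\<lambda>n. \<iota> \<one>) (\<Phi> x)"
    using continuous_map_limit[OF cont x] ext' s_in s(2) by (simp add: o_def)
  moreover have "?lim (\<lambda>n. \<iota> (\<phi> k)) (\<Phi> x)"
    using continuous_map_limit[OF cont y] ext'[OF s_in(2)] s(3) by (simp add: o_def)
  ultimately have "(\<lambda>n. e (\<iota> \<one>) (\<iota> (\<phi> k))) \<longlonglongrightarrow> e (\<Phi> x) (\<Phi> x)"
    using Metric_space_tendsto_dist[OF N.Metric_space_axioms] by fastforce
  then have "e (\<iota> \<one>) (\<iota> (\<phi> k)) = e (\<Phi> x) (\<Phi> x)"
    using LIMSEQ_unique[OF tendsto_const] by blast
  moreover have "\<Phi> x \<in> N"
    using cont x_in unfolding continuous_map_def by auto
  ultimately have "d \<one> (\<phi> k) = 0"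
    using compl'(3)[of \<one> "\<phi> k"] k(1) by simp
  then show False
    using k by simp
qed

end

theorem corollary5p2:
  fixes G :: "('a, 'm) monoid_scheme"
    and A :: "'a set" and p :: 'a and \<gamma> T :: real
    and d :: "'a \<Rightarrow> 'a \<Rightarrow> real"
    and \<phi> :: "'a \<Rightarrow> 'a"
    and \<iota> :: "'a \<Rightarrow> 'b" and Ghat :: "'b set" and dhat :: "'b \<Rightarrow> 'b \<Rightarrow> real"
  assumes "group G" and "virtually_free G"
    and "finite A" and "A \<subseteq> carrier G" and "generate G A = carrier G"
    and "\<phi> \<in> hom G G" and "\<phi> ` carrier G \<noteq> {\<one>\<^bsub>G\<^esub>}"
    and "p \<in> carrier G" and "\<gamma> > 0" and "T \<ge> 1"
    and "d \<in> visual_metrics G A p \<gamma> T"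
    and "metric_completion_of (carrier G) d \<iota> Ghat dhat"
  shows "all_equivalent
    [uniformly_continuous_map (metric (carrier G, d)) (metric (carrier G, d)) \<phi>,
     Holder_condition (carrier G) d (carrier G) d \<phi>,
     \<exists>\<Phi>. extends_along (carrier G) \<iota> \<phi> \<Phi> \<and>
        continuous_map (Metric_space.mtopology Ghat dhat) (Metric_space.mtopology Ghat dhat) \<Phi>,
     \<exists>\<Phi>. extends_along (carrier G) \<iota> \<phi> \<Phi> \<and> Holder_condition Ghat dhat Ghat dhat \<Phi>,
     \<exists>P>0. \<exists>Q. \<forall>g\<in>carrier G. \<forall>h\<in>carrier G.
        P * gromov_product G A p (\<phi> g) (\<phi> h) + Q \<ge> gromov_product G A p g h,
     quasi_isometric_embedding (carrier G) (word_dist G A) (carrier G) (word_dist G A) \<phi>,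
     virtually_injective G \<phi>]"
proof -
  interpret visual_endomorphism G A p \<gamma> T d \<phi>
    using assms by (intro visual_endomorphism.intro visual_metric.intro marked_group.intro
        marked_group_axioms.intro visual_metric_axioms.intro visual_endomorphism_axioms.intro)
  \<comment> \<open>Nontriviality supplies the element \<open>k\<close> that separates the images in
    the implications from (i) and (iii) to (vii).\<close>
  have "\<exists>k\<in>carrier G. \<phi> k \<noteq> \<one>\<^bsub>G\<^esub>"
  proof (rule ccontr)
    assume "\<not> ?thesis"
    then have "\<phi> ` carrier G = (\<lambda>_. \<one>\<^bsub>G\<^esub>) ` carrier G"
      by (intro image_cong) simp_all
    also have "\<dots> = {\<one>\<^bsub>G\<^esub>}"
      by (rule image_constant[OF p])
    finally show False
      using assms(7) by contradiction
  qed
  then obtain k where k: "k \<in> carrier G" "\<phi> k \<noteq> \<one>\<^bsub>G\<^esub>"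
    by (elim bexE)
  have Ghat: "Metric_space Ghat dhat"
    using assms(12) unfolding metric_completion_of_def by blast
  let ?i = "uniformly_continuous_map (metric (carrier G, d)) (metric (carrier G, d)) \<phi>"
  let ?ii = "Holder_condition (carrier G) d (carrier G) d \<phi>"
  let ?iii = "\<exists>\<Phi>. extends_along (carrier G) \<iota> \<phi> \<Phi> \<and>
    continuous_map (Metric_space.mtopology Ghat dhat) (Metric_space.mtopology Ghat dhat) \<Phi>"
  let ?iv = "\<exists>\<Phi>. extends_along (carrier G) \<iota> \<phi> \<Phi> \<and> Holder_condition Ghat dhat Ghat dhat \<Phi>"
  let ?v = "\<exists>P>0. \<exists>Q. \<forall>g\<in>carrier G. \<forall>h\<in>carrier G.
    P * gromov_product G A p (\<phi> g) (\<phi> h) + Q \<ge> gromov_product G A p g h"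
  let ?vi = "quasi_isometric_embedding (carrier G) (word_dist G A) (carrier G) (word_dist G A) \<phi>"
  let ?vii = "virtually_injective G \<phi>"
  \<comment> \<open>Three cycles share the step from (vii) to (v): they go on from (v) to (vi), from
    (v) via (ii) to (i), and from (v) via (ii) and (iv) to (iii), each returning to (vii).\<close>
  have "?vii \<Longrightarrow> ?v"
    using virtually_free_coarse_embedding[OF assms(2)] gp_hom_lower_bound[OF _ assms(6) _ p]
    unfolding virtually_injective_def by blast
  moreover have "?v \<Longrightarrow> ?ii"
    using Holder_condition_if_gp_bound by blast
  moreover have "?v \<Longrightarrow> ?vi"
    using quasi_isometric_embedding_if_gp_bound by blast
  moreover have "?vi \<Longrightarrow> ?vii"
    using finite_kernel_if_quasi_isometric_embedding unfolding virtually_injective_def .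
  moreover have "?ii \<Longrightarrow> ?i"
    by (rule Holder_condition_imp_uniformly_continuous_map[OF Metric_space_d Metric_space_d])
  moreover have "?i \<Longrightarrow> ?vii"
    using finite_kernel_if_uniformly_continuous_map k unfolding virtually_injective_def by blast
  moreover have "?ii \<Longrightarrow> ?iv"
    by (rule Holder_condition_extends_to_completion[OF Metric_space_d assms(12)])
  moreover have "?iv \<Longrightarrow> ?iii"
    using Holder_condition_imp_continuous_map[OF Ghat Ghat] by blast
  moreover have "?iii \<Longrightarrow> ?vii"
    using finite_kernel_if_continuous_extension[OF assms(12) _ _ k]
    unfolding virtually_injective_def by blast
  ultimately have "?i = ?vii" "?ii = ?vii" "?iii = ?vii" "?iv = ?vii" "?v = ?vii" "?vi = ?vii"
    by argo+
  then show ?thesis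
    unfolding all_equivalent_def by simp
qed

end
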